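(* Let $a\ge1$ and $\frac1a+\frac1b=1$. Let $g:\mathbb{R}^n\to\mathbb{R}$ have the form $g(\mathbf{x})=\tilde g(\mathbf{x}^{(1)})+\boldsymbol\beta^T\mathbf{x}^{(2)}$, where $\mathbf{x}=(\mathbf{x}^{(1)},\mathbf{x}^{(2)})$, $\mathbf{x}^{(1)}\in\mathbb{R}^m$, $\mathbf{x}^{(2)}\in\mathbb{R}^{n-m}$, $m\le n$, $\boldsymbol\beta\in\mathbb{R}^{n-m}$, and $\tilde g:\mathbb{R}^m\to\mathbb{R}$ is locally Lipschitz. Let $\mathbf{X}=(\mathbf{X}^{(1)},\mathbf{X}^{(2)})\in\mathcal{L}^p_n$ (with $\mathbf{X}^{(1)}$ the first $m$ components) satisfy $g(\mathbf{X})\in\mathcal{L}^p$, and let $C\subseteq\mathbb{R}^m$ be a compact set with $\mathrm{supp}(\mathbf{X}^{(1)})\subseteq C$. Then for any $\epsilon\ge0$, $$\mathcal{U}_{\|\boldsymbol\beta\|_b\epsilon}(g(\mathbf{X}))\subseteq g\big(\mathcal{U}^{n,m}_{\epsilon,C}(\mathbf{X})\big)\subseteq\mathcal{U}_{K_C\epsilon}\big(g(\mathbf{X})\big),$$ where $K_C$ is the Lipschitz constant of $g$ restricted to $C\times\mathbb{R}^{n-m}$. Moreover, $K_C\le\min\{L_C+\|\boldsymbol\beta\|_b,\ n^{\frac1b}\max\{L_C,\|\boldsymbol\beta\|_b\}\}$, where $L_C$ is the Lipschitz constant of $\tilde g$ restricted to $C$.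
   Context: Fix $p\ge 1$ and a non-atomic probability space $(\Omega,\mathcal{B},\mathbb{P})$ with $\mathcal{B}=\mathcal{B}(\mathbb{R}^n)$; all random variables/vectors live on it. $\|\mathbf{x}\|_a=(\sum_i|x_i|^a)^{1/a}$; $b=\infty$ (max norm, $n^{1/b}=1$) when $a=1$. $\mathcal{L}^p_n$ is the space of $n$-dimensional random vectors $\mathbf{X}$ with $\mathbb{E}[\|\mathbf{X}\|_a^p]<\infty$, $\mathcal{L}^p=\mathcal{L}^p_1$. $F_{\mathbf{X}}$ is the cdf and $\mathrm{supp}$ the support of a random vector. For cdfs $F,G$ on $\mathbb{R}^n$ with finite $p$-th moments, $W^n(F,G)=\inf (\mathbb{E}[\|\mathbf{X}-\mathbf{Y}\|_a^p])^{1/p}$ over all couplings with $F_{\mathbf{X}}=F$, $F_{\mathbf{Y}}=G$; $W=W^1$. $\mathcal{U}_\epsilon(X)=\{Z\in\mathcal{L}^p: W(F_Z,F_X)\le\epsilon\}$ for a random variable $X\in\mathcal{L}^p$, and $$\mathcal{U}^{n,m}_{\epsilon,C}(\mathbf{X})=\{\mathbf{Z}\in\mathcal{L}^p_n: W^n(F_{\mathbf{Z}},F_{\mathbf{X}})\le\epsilon\ \text{and}\ \mathrm{supp}((Z_1,\dots,Z_m))\subseteq C\}.$$ $g(\mathcal{S})=\{g(\mathbf{Z}):\mathbf{Z}\in\mathcal{S}\}$ for a set $\mathcal S$ of random vectors. A function is locally Lipschitz if every point has a neighbourhood on which it is Lipschitz (locally Lipschitz functions are Lipschitz on compact sets, so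 $L_C$ is finite). Lipschitz constants are the smallest ones, with respect to $\|\cdot\|_a$. Standing assumption: $g$ is non-constant.
   Formalization: The first inclusion is proved up to equality in distribution: each Z in the ball around g(X) has the same cdf as g(Y) for some Y in the ball around X. With pointwise equality it is false, e.g. g(x)=|x|, X uniform on [-1,1], ε=0. *)

theory Defs
  imports "HOL-Probability.Probability"
begin

text \<open>
  A vector of \<open>\<real>\<^sup>k\<close> is an extensional function on \<open>{..<k}\<close>, with coordinates numbered from 0;
  \<open>k = 0\<close> is allowed, so that either block of a vector may be empty.
\<close>

definition Rvec :: "nat \<Rightarrow> (nat \<Rightarrow> real) set" where
  "Rvec k = PiE {..<k} (\<lambda>_. UNIV)"

definition Rtop :: "nat \<Rightarrow> (nat \<Rightarrow> real) topology" where
  "Rtop k = product_topology (\<lambda>_. euclideanreal) {..<k}"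

definition Rborel :: "nat \<Rightarrow> (nat \<Rightarrow> real) measure" where
  "Rborel k = PiM {..<k} (\<lambda>_. borel)"

definition block1 :: "nat \<Rightarrow> (nat \<Rightarrow> real) \<Rightarrow> nat \<Rightarrow> real" where
  "block1 m x = restrict x {..<m}"

definition block2 :: "nat \<Rightarrow> nat \<Rightarrow> (nat \<Rightarrow> real) \<Rightarrow> nat \<Rightarrow> real" where
  "block2 m n x = (\<lambda>i\<in>{..<n - m}. x (m + i))"

text \<open>The inserted 0 gives the max norm of the empty vector the value 0.\<close>

definition vnorm :: "ereal \<Rightarrow> nat \<Rightarrow> (nat \<Rightarrow> real) \<Rightarrow> real" where
  "vnorm q k x =
     (if q = \<infinity> then Max (insert 0 ((\<lambda>i. \<bar>x i\<bar>) ` {..<k}))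
      else (\<Sum>i<k. \<bar>x i\<bar> powr real_of_ereal q) powr (1 / real_of_ereal q))"

abbreviation vdist :: "real \<Rightarrow> nat \<Rightarrow> (nat \<Rightarrow> real) \<Rightarrow> (nat \<Rightarrow> real) \<Rightarrow> real" where
  "vdist a k x y \<equiv> vnorm (ereal a) k (\<lambda>i. x i - y i)"

definition lipschitz_bound ::
  "real \<Rightarrow> nat \<Rightarrow> (nat \<Rightarrow> real) set \<Rightarrow> ((nat \<Rightarrow> real) \<Rightarrow> real) \<Rightarrow> real \<Rightarrow> bool" where
  "lipschitz_bound a k S f L \<longleftrightarrow>
     0 \<le> L \<and> (\<forall>x\<in>S. \<forall>y\<in>S. \<bar>f x - f y\<bar> \<le> L * vdist a k x y)"

text \<open>The infimum is attained whenever \<open>f\<close> is Lipschitz on \<open>S\<close>.\<close>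

definition lipschitz_constant ::
  "real \<Rightarrow> nat \<Rightarrow> (nat \<Rightarrow> real) set \<Rightarrow> ((nat \<Rightarrow> real) \<Rightarrow> real) \<Rightarrow> real" where
  "lipschitz_constant a k S f = Inf {L. lipschitz_bound a k S f L}"

definition locally_lipschitz :: "real \<Rightarrow> nat \<Rightarrow> ((nat \<Rightarrow> real) \<Rightarrow> real) \<Rightarrow> bool" where
  "locally_lipschitz a k f \<longleftrightarrow>
     (\<forall>x\<in>Rvec k. \<exists>U L. openin (Rtop k) U \<and> x \<in> U \<and> lipschitz_bound a k U f L)"

definition nonatomic :: "'w measure \<Rightarrow> bool" where
  "nonatomic M \<longleftrightarrow>
     (\<forall>A\<in>sets M. 0 < measure M A \<longrightarrow>
        (\<exists>B\<in>sets M. B \<subseteq> A \<and> 0 < measure M B \<and> measure M B < measure M A))"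

definition vcdf :: "'w measure \<Rightarrow> nat \<Rightarrow> ('w \<Rightarrow> nat \<Rightarrow> real) \<Rightarrow> (nat \<Rightarrow> real) \<Rightarrow> real" where
  "vcdf M k X = (\<lambda>x. measure M {\<omega>\<in>space M. \<forall>i<k. X \<omega> i \<le> x i})"

abbreviation rcdf :: "'w measure \<Rightarrow> ('w \<Rightarrow> real) \<Rightarrow> real \<Rightarrow> real" where
  "rcdf M X \<equiv> cdf (distr M borel X)"

definition support :: "'w measure \<Rightarrow> nat \<Rightarrow> ('w \<Rightarrow> nat \<Rightarrow> real) \<Rightarrow> (nat \<Rightarrow> real) set" where
  "support M k X =
     {x\<in>Rvec k. \<forall>U. openin (Rtop k) U \<and> x \<in> U \<longrightarrow> 0 < measure M {\<omega>\<in>space M. X \<omega> \<in> U}}"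

definition Lp_vec :: "'w measure \<Rightarrow> real \<Rightarrow> real \<Rightarrow> nat \<Rightarrow> ('w \<Rightarrow> nat \<Rightarrow> real) set" where
  "Lp_vec M p a k =
     {X \<in> measurable M (Rborel k). integrable M (\<lambda>\<omega>. vnorm (ereal a) k (X \<omega>) powr p)}"

definition Lp_real :: "'w measure \<Rightarrow> real \<Rightarrow> ('w \<Rightarrow> real) set" where
  "Lp_real M p = {X \<in> borel_measurable M. integrable M (\<lambda>\<omega>. \<bar>X \<omega>\<bar> powr p)}"

text \<open>
  The couplings range over pairs of random vectors on the underlying space \<open>M\<close>.
  In dimension one, \<open>\<parallel>x\<parallel>\<^sub>a = \<bar>x\<bar>\<close> for every \<open>a\<close>, and random variables are kept real-valued.
\<close>

definition wasserstein_vec ::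
  "'w measure \<Rightarrow> real \<Rightarrow> real \<Rightarrow> nat \<Rightarrow> ((nat \<Rightarrow> real) \<Rightarrow> real) \<Rightarrow> ((nat \<Rightarrow> real) \<Rightarrow> real) \<Rightarrow> real" where
  "wasserstein_vec M p a k F G =
     Inf {(LINT \<omega>|M. vdist a k (X \<omega>) (Y \<omega>) powr p) powr (1 / p) | X Y.
            X \<in> measurable M (Rborel k) \<and> Y \<in> measurable M (Rborel k) \<and>
            vcdf M k X = F \<and> vcdf M k Y = G}"

definition wasserstein_real ::
  "'w measure \<Rightarrow> real \<Rightarrow> (real \<Rightarrow> real) \<Rightarrow> (real \<Rightarrow> real) \<Rightarrow> real" where
  "wasserstein_real M p F G =
     Inf {(LINT \<omega>|M. \<bar>X \<omega> - Y \<omega>\<bar> powr p) powr (1 / p) | X Y.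
            X \<in> borel_measurable M \<and> Y \<in> borel_measurable M \<and>
            rcdf M X = F \<and> rcdf M Y = G}"

definition ball_real :: "'w measure \<Rightarrow> real \<Rightarrow> real \<Rightarrow> ('w \<Rightarrow> real) \<Rightarrow> ('w \<Rightarrow> real) set" where
  "ball_real M p \<epsilon> X =
     {Z \<in> Lp_real M p. wasserstein_real M p (rcdf M Z) (rcdf M X) \<le> \<epsilon>}"

definition ball_vec ::
  "'w measure \<Rightarrow> real \<Rightarrow> real \<Rightarrow> nat \<Rightarrow> nat \<Rightarrow> real \<Rightarrow> (nat \<Rightarrow> real) set \<Rightarrow>
   ('w \<Rightarrow> nat \<Rightarrow> real) \<Rightarrow> ('w \<Rightarrow> nat \<Rightarrow> real) set" where
  "ball_vec M p a n m \<epsilon> C X =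
     {Z \<in> Lp_vec M p a n.
        wasserstein_vec M p a n (vcdf M n Z) (vcdf M n X) \<le> \<epsilon> \<and>
        support M m (\<lambda>\<omega>. block1 m (Z \<omega>)) \<subseteq> C}"

definition rv_image ::
  "((nat \<Rightarrow> real) \<Rightarrow> real) \<Rightarrow> ('w \<Rightarrow> nat \<Rightarrow> real) set \<Rightarrow> ('w \<Rightarrow> real) set" where
  "rv_image g S = (\<lambda>Z \<omega>. g (Z \<omega>)) ` S"

text \<open>
  Uncertainty sets are determined by distributions, and a set of random variables is read up to
  equality in distribution where it serves as an upper bound for such a set. With pointwise
  equality, a Wasserstein ball around \<open>g(X)\<close> need not lie in the image of a ball around \<open>X\<close>:
  let \<open>M\<close> be the uniform distribution on \<open>[0,1]\<close>, \<open>n = m = 1\<close>, \<open>g(x) = \<bar>x\<bar>\<close>,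
  \<open>X(\<omega>) = 2\<omega> - 1\<close>, \<open>C = [-1,1]\<close> and \<open>\<epsilon> = 0\<close>.
  The variable \<open>Z(\<omega>) = \<omega>\<close> has the distribution of \<open>g(X)\<close>, but no \<open>Y\<close> with the distribution of
  \<open>X\<close> satisfies \<open>\<bar>Y\<bar> = Z\<close>: for \<open>A = {\<omega> \<in> [0,1]. Y(\<omega>) = \<omega>}\<close> it would follow that
  \<open>P(A \<inter> B) = P(B) / 2\<close> for every Borel set \<open>B \<subseteq> [0,1]\<close>, in particular for \<open>B = A\<close> and
  \<open>B = [0,1]\<close>.
\<close>

definition law_hull :: "'w measure \<Rightarrow> ('w \<Rightarrow> real) set \<Rightarrow> ('w \<Rightarrow> real) set" where
  "law_hull M S = {Z \<in> borel_measurable M. \<exists>Y\<in>S. rcdf M Z = rcdf M Y}"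

end

theory Submission
  imports Defs
begin

text \<open>
  For the lower inclusion, let \<open>V = g(X)\<close>. On a non-atomic space there is a copy \<open>Z'\<close> of \<open>Z\<close> that is
  comonotone with the given variable \<open>V\<close>: the atoms of \<open>V\<close> are split to obtain an atomless \<open>W\<close> of
  which \<open>V\<close> is a nondecreasing function, and \<open>Z'\<close> is the quantile function of \<open>Z\<close> applied to
  \<open>F\<^sub>W(W)\<close>. Comonotone couplings are optimal on the real line, so the Wasserstein distance between
  the laws of \<open>Z\<close> and \<open>V\<close> is attained at the pair \<open>(Z', V)\<close>. Moving the second block of \<open>X\<close> by \<open>(Z' - V) / \<parallel>\<beta>\<parallel>\<^sub>b\<close>
  times a dual unit vector of \<open>\<beta>\<close> gives \<open>Y\<close> with \<open>g(Y) = Z'\<close> and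
  \<open>\<parallel>Y - X\<parallel>\<^sub>a = \<bar>Z' - V\<bar> / \<parallel>\<beta>\<parallel>\<^sub>b\<close>. For the upper inclusion, any coupling of \<open>Z\<close> and \<open>X\<close> lives on
  \<open>C \<times> \<real>\<^bsup>n-m\<^esup>\<close> almost surely, where \<open>g\<close> is Lipschitz.
\<close>

section \<open>The vector norms\<close>

text \<open>The delicate point of the lower inclusion is that \<open>Y\<close> must live on the same
  sample points as the given \<open>X\<close>, whose information may already exhaust
  \<open>M\<close>; randomness independent of \<open>X\<close> cannot be assumed. The optimal
  coupling therefore has to keep \<open>V\<close> itself and not merely a copy of its law. The
  monotone coupling on the line makes this possible: it uses randomness beyond \<open>V\<close> only
  inside the atoms of \<open>V\<close>, and there the non-atomicity of \<open>M\<close> supplies it.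
  Attainment matters too, since a nearly optimal pair would put \<open>Y\<close> only into a
  slightly larger ball. If \<beta> has norm 0, no shift of the second block changes
  \<open>g\<close>, but then the radius is 0 and \<open>Y = X\<close> works. In the upper inclusion
  the competing couplings carry no support condition. Membership in C x R^(n-m) passes to them
  because it depends only on the marginal laws. Both estimates of K_C start from |g x - g y| <= L u
  + B v, where u and v are the distances of the two blocks: either u and v are each bounded by the
  full distance, or Hoelder's inequality in the plane is applied to u + v.\<close>

lemma vnorm_real: "vnorm (ereal q) k x = (\<Sum>i<k. \<bar>x i\<bar> powr q) powr (1 / q)"
  by (simp add: vnorm_def)

lemma vnorm_nonneg: "0 \<le> vnorm q k x"
  by (auto simp: vnorm_def intro: Max_ge)

lemma vnorm_cong: "(\<And>i. i < k \<Longrightarrow> \<bar>x i\<bar> = \<bar>y i\<bar>) \<Longrightarrow> vnorm q k x = vnorm q k y"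
  unfolding vnorm_def by (intro if_cong arg_cong[where f = Max] arg_cong2[where f = "(powr)"] sum.cong) auto

lemma vnorm_powr: "q \<noteq> 0 \<Longrightarrow> vnorm (ereal q) k x powr q = (\<Sum>i<k. \<bar>x i\<bar> powr q)"
  by (simp add: vnorm_real powr_powr sum_nonneg)

lemma vnorm_zero: "(\<And>i. i < k \<Longrightarrow> x i = 0) \<Longrightarrow> vnorm q k x = 0"
proof -
  assume *: "\<And>i. i < k \<Longrightarrow> x i = 0"
  have "insert 0 ((\<lambda>i. \<bar>x i\<bar>) ` {..<k}) = {0}"
    using * by auto
  then have "Max (insert 0 ((\<lambda>i. \<bar>x i\<bar>) ` {..<k})) = 0"
    by (simp only: Max_singleton)
  moreover have "(\<Sum>i<k. \<bar>x i\<bar> powr real_of_ereal q) = 0"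
    using * by simp
  ultimately show ?thesis
    unfolding vnorm_def by simp
qed

lemma abs_le_vnorm:
  assumes "q > 0" "i < k"
  shows "\<bar>x i\<bar> \<le> vnorm (ereal q) k x"
proof -
  have "\<bar>x i\<bar> powr q \<le> (\<Sum>i<k. \<bar>x i\<bar> powr q)"
    by (rule member_le_sum[where f = "\<lambda>i. \<bar>x i\<bar> powr q"]) (use assms in auto)
  then have "(\<bar>x i\<bar> powr q) powr (1 / q) \<le> vnorm (ereal q) k x"
    using assms by (simp add: vnorm_real powr_mono2)
  then show ?thesis
    using assms by (simp add: powr_powr)
qed

text \<open>Let S be the l1 norm. Splitting off one factor gives |x_i|^q <= |x_i| S^(q-1), since
  each entry is at most S, and summation yields S^q.\<close>

lemma vnorm_le_sum:
  assumes "q \<ge> 1"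
  shows "vnorm (ereal q) k x \<le> (\<Sum>i<k. \<bar>x i\<bar>)"
proof -
  let ?S = "\<Sum>i<k. \<bar>x i\<bar>"
  have powr_split: "s powr q = s * s powr (q - 1)" if "s \<ge> 0" for s :: real
    using that powr_add[of s 1 "q - 1"] by simp
  have "\<bar>x i\<bar> powr q \<le> \<bar>x i\<bar> * ?S powr (q - 1)" if "i < k" for i
  proof -
    have "\<bar>x i\<bar> \<le> ?S"
      by (rule member_le_sum[where f = "\<lambda>i. \<bar>x i\<bar>"]) (use that in auto)
    then show ?thesis
      using assms by (simp add: powr_split mult_left_mono powr_mono2)
  qed
  then have "(\<Sum>i<k. \<bar>x i\<bar> powr q) \<le> (\<Sum>i<k. \<bar>x i\<bar> * ?S powr (q - 1))"
    by (intro sum_mono) auto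
  also have "\<dots> = ?S powr q"
    by (simp add: sum_distrib_right[symmetric] powr_split[of ?S] sum_nonneg)
  finally have "vnorm (ereal q) k x \<le> (?S powr q) powr (1 / q)"
    using assms by (simp add: vnorm_real powr_mono2 sum_nonneg)
  then show ?thesis
    using assms by (simp add: powr_powr sum_nonneg)
qed

lemma vnorm_eq_0_imp:
  assumes "vnorm (ereal q) k x = 0" "q > 0" "i < k"
  shows "x i = 0"
  using abs_le_vnorm[OF assms(2,3), of x] assms(1) by simp

section \<open>Conjugate exponents: Hoelder's inequality and its equality case\<close>

lemma conjugate_exponents_cases [consumes 3, case_names one real]:
  fixes a :: real and b :: ereal
  assumes "a \<ge> 1" "b \<ge> 1" "1 / ereal a + 1 / b = 1"
  obtains (one) "a = 1" "b = \<infinity>"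
  | (real) b' where "b = ereal b'" "a > 1" "b' > 1" "1 / a + 1 / b' = 1"
proof (cases b)
  case (real b')
  with assms have eq: "1 / a + 1 / b' = 1"
    by (simp add: one_ereal_def)
  have "a \<noteq> 1" "b' \<noteq> 1"
    using eq assms(1,2) real by auto
  with assms real have "a > 1" "b' > 1"
    by auto
  with eq show ?thesis
    using that(2) real by blast
next
  case PInf
  with assms have "1 / a = 1"
    by (simp add: one_ereal_def)
  with assms PInf show ?thesis
    using that(1) by simp
next
  case MInf
  with assms show ?thesis by simp
qed

text \<open>For real exponents both vectors are scaled to norm one; Young's inequality then applies
  in each coordinate, and the right-hand sides add up to 1/a + 1/b' = 1. A vector of norm zero
  cannot be scaled, but all its coordinates vanish.\<close>

lemma Hoelder_sum:
  fixes a :: real and b :: ereal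
  assumes "a \<ge> 1" "b \<ge> 1" "1 / ereal a + 1 / b = 1"
  shows "\<bar>\<Sum>i<k. \<beta> i * x i\<bar> \<le> vnorm b k \<beta> * vnorm (ereal a) k x"
  using assms
proof (cases rule: conjugate_exponents_cases)
  case one
  have "\<bar>\<Sum>i<k. \<beta> i * x i\<bar> \<le> (\<Sum>i<k. \<bar>\<beta> i * x i\<bar>)"
    by (rule sum_abs)
  also have "\<dots> \<le> (\<Sum>i<k. vnorm \<infinity> k \<beta> * \<bar>x i\<bar>)"
    by (intro sum_mono) (auto simp: vnorm_def abs_mult intro!: mult_right_mono Max_ge)
  also have "\<dots> = vnorm b k \<beta> * vnorm (ereal a) k x"
    using one by (simp add: vnorm_real sum_distrib_left sum_nonneg)
  finally show ?thesis .
next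
  case (real b')
  let ?A = "vnorm (ereal a) k x" and ?B = "vnorm (ereal b') k \<beta>"
  show ?thesis
  proof (cases "?A = 0 \<or> ?B = 0")
    case True
    with real have "\<beta> i * x i = 0" if "i < k" for i
      using that vnorm_eq_0_imp[of a k x i] vnorm_eq_0_imp[of b' k \<beta> i] by auto
    then have "(\<Sum>i<k. \<beta> i * x i) = 0"
      by (intro sum.neutral) auto
    then show ?thesis
      by (simp add: vnorm_nonneg)
  next
    case False
    then have pos: "?A > 0" "?B > 0"
      using vnorm_nonneg[of _ k] by (auto simp: less_le)
    have "\<bar>\<beta> i / ?B * (x i / ?A)\<bar> \<le> \<bar>x i / ?A\<bar> powr a / a + \<bar>\<beta> i / ?B\<bar> powr b' / b'" for i
      using Youngs_inequality[of a b' "\<bar>x i / ?A\<bar>" "\<bar>\<beta> i / ?B\<bar>"] real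
      by (simp add: abs_mult mult.commute)
    then have "(\<Sum>i<k. \<bar>\<beta> i / ?B * (x i / ?A)\<bar>)
        \<le> (\<Sum>i<k. \<bar>x i / ?A\<bar> powr a / a + \<bar>\<beta> i / ?B\<bar> powr b' / b')"
      by (intro sum_mono)
    also have "\<dots> = (\<Sum>i<k. \<bar>x i\<bar> powr a) / ?A powr a / a + (\<Sum>i<k. \<bar>\<beta> i\<bar> powr b') / ?B powr b' / b'"
      using pos by (simp add: sum.distrib sum_divide_distrib powr_divide abs_divide)
    also have "\<dots> = 1"
      using pos real by (simp flip: vnorm_powr)
    finally have le1: "(\<Sum>i<k. \<bar>\<beta> i / ?B * (x i / ?A)\<bar>) \<le> 1" .
    have "\<bar>\<Sum>i<k. \<beta> i * x i\<bar> \<le> (\<Sum>i<k. \<bar>\<beta> i * x i\<bar>)"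
      by (rule sum_abs)
    also have "\<dots> = ?B * ?A * (\<Sum>i<k. \<bar>\<beta> i / ?B * (x i / ?A)\<bar>)"
      using pos by (simp add: sum_distrib_left abs_mult)
    also have "\<dots> \<le> ?B * ?A * 1"
      using pos by (intro mult_left_mono le1) auto
    finally show ?thesis
      using real by simp
  qed
qed

text \<open>Hoelder's inequality in the plane against the vector (1, 1), whose b-norm is 2^(1/b);
  for infinite b this reads 2^0 = 1.\<close>

lemma add_le_vnorm_2:
  fixes a u v :: real and b :: ereal
  assumes "a \<ge> 1" "b \<ge> 1" "1 / ereal a + 1 / b = 1" "u \<ge> 0" "v \<ge> 0"
  shows "u + v \<le> 2 powr real_of_ereal (1 / b) * (u powr a + v powr a) powr (1 / a)"
proof -
  have "vnorm b 2 (\<lambda>_. 1) = 2 powr real_of_ereal (1 / b)"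
  using assms(1-3)
  proof (cases rule: conjugate_exponents_cases)
    case one
    have "insert (0::real) ((\<lambda>_. 1) ` {..<2::nat}) = {0, 1}"
      by (auto simp: image_constant_conv lessThan_empty_iff bot_nat_def)
    with one show ?thesis
      by (simp add: vnorm_def)
  qed (auto simp: vnorm_real one_ereal_def)
  then show ?thesis
    using Hoelder_sum[OF assms(1-3), where k = 2 and \<beta> = "\<lambda>_. 1" and x = "\<lambda>i. if i = 0 then u else v"] assms(4,5)
    by (simp add: vnorm_real numeral_2_eq_2)
qed

text \<open>A unit vector for which Hoelder's inequality is an equality. In this direction a linear
  form grows fastest, so a prescribed change of its value is obtained at the least cost.\<close>

lemma dual_vector:
  fixes a :: real and b :: ereal
  assumes "a \<ge> 1" "b \<ge> 1" "1 / ereal a + 1 / b = 1" "vnorm b k \<beta> \<noteq> 0"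
  obtains d where "(\<Sum>i<k. \<beta> i * d i) = vnorm b k \<beta>" "vnorm (ereal a) k d = 1"
  using assms(1-3)
proof (cases rule: conjugate_exponents_cases)
  case one
  have "Max (insert 0 ((\<lambda>i. \<bar>\<beta> i\<bar>) ` {..<k})) \<in> insert 0 ((\<lambda>i. \<bar>\<beta> i\<bar>) ` {..<k})"
    by (rule Max_in) auto
  \<comment> \<open>The norm is nonzero, so the maximum is attained at a coordinate and not only at
    the inserted 0.\<close>
  then obtain j where j: "j < k" "vnorm b k \<beta> = \<bar>\<beta> j\<bar>"
    using assms(4) one by (auto simp: vnorm_def)
  define d where "d = (\<lambda>i. if i = j then sgn (\<beta> j) else 0)"
  have "(\<Sum>i<k. \<beta> i * d i) = (\<Sum>i<k. if i = j then \<beta> j * sgn (\<beta> j) else 0)"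
    by (rule sum.cong) (auto simp: d_def)
  also have "\<dots> = vnorm b k \<beta>"
    using j by (simp add: abs_sgn[symmetric])
  finally have 1: "(\<Sum>i<k. \<beta> i * d i) = vnorm b k \<beta>" .
  have "(\<Sum>i<k. \<bar>d i\<bar>) = (\<Sum>i<k. if i = j then \<bar>sgn (\<beta> j)\<bar> else 0)"
    by (rule sum.cong) (auto simp: d_def)
  also have "\<dots> = 1"
    using j assms(4) by (auto simp: abs_sgn_eq)
  finally have "vnorm (ereal a) k d = 1"
    using one by (simp add: vnorm_real)
  with 1 show ?thesis
    using that by blast
next
  case (real b')
  let ?B = "vnorm (ereal b') k \<beta>"
  have pos: "?B > 0"
    using assms(4) real vnorm_nonneg[of b k \<beta>] by (simp add: less_le)
  have conj: "(b' - 1) * a = b'"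
    using real by (simp add: field_simps)
  \<comment> \<open>Equality in Young's inequality requires |d_i|^a to be proportional to
    |beta_i|^b', and (b' - 1) a = b' turns this into the exponent b' - 1.\<close>
  define d where "d = (\<lambda>i. sgn (\<beta> i) * (\<bar>\<beta> i\<bar> / ?B) powr (b' - 1))"
  have abs_d: "\<bar>d i\<bar> = (\<bar>\<beta> i\<bar> / ?B) powr (b' - 1)" for i
    using pos by (auto simp: d_def abs_mult abs_sgn_eq)
  have "\<beta> i * d i = ?B * (\<bar>\<beta> i\<bar> / ?B) powr b'" for i
  proof -
    have "\<beta> i * d i = ?B * ((\<bar>\<beta> i\<bar> / ?B) * (\<bar>\<beta> i\<bar> / ?B) powr (b' - 1))"
      using pos by (simp add: d_def abs_sgn[symmetric] mult.assoc[symmetric])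
    also have "\<dots> = ?B * (\<bar>\<beta> i\<bar> / ?B) powr b'"
      using powr_add[of "\<bar>\<beta> i\<bar> / ?B" 1 "b' - 1"] pos by simp
    finally show ?thesis .
  qed
  moreover have sum1: "(\<Sum>i<k. (\<bar>\<beta> i\<bar> / ?B) powr b') = 1"
  proof -
    have "(\<Sum>i<k. (\<bar>\<beta> i\<bar> / ?B) powr b') = (\<Sum>i<k. \<bar>\<beta> i\<bar> powr b') / ?B powr b'"
      using pos by (simp add: sum_divide_distrib powr_divide)
    then show ?thesis
      using pos real by (simp flip: vnorm_powr)
  qed
  ultimately have 1: "(\<Sum>i<k. \<beta> i * d i) = vnorm b k \<beta>"
    using real by (simp add: sum_distrib_left[symmetric])
  have "(\<Sum>i<k. \<bar>d i\<bar> powr a) = 1"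
    using sum1 by (simp add: abs_d powr_powr conj)
  then have "vnorm (ereal a) k d = 1"
    by (simp add: vnorm_real)
  with 1 show ?thesis
    using that by blast
qed

lemma sum_blocks:
  fixes f :: "nat \<Rightarrow> real"
  assumes "m \<le> n"
  shows "(\<Sum>i<n. f i) = (\<Sum>i<m. f i) + (\<Sum>i<n - m. f (m + i))"
proof -
  have "(\<Sum>i<n. f i) = (\<Sum>i<m. f i) + (\<Sum>i=m..<n. f i)"
    using assms by (metis atLeast0LessThan le0 sum.atLeastLessThan_concat)
  also have "(\<Sum>i=m..<n. f i) = (\<Sum>i<n - m. f (m + i))"
    using sum.shift_bounds_nat_ivl[of f 0 m "n - m"] assms by (simp add: atLeast0LessThan add.commute)
  finally show ?thesis .
qed

lemma vnorm_blocks: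
  assumes "m \<le> n" "q > 0"
  shows "vnorm (ereal q) n x powr q
       = vnorm (ereal q) m x powr q + vnorm (ereal q) (n - m) (\<lambda>i. x (m + i)) powr q"
  using assms by (simp add: vnorm_powr sum_blocks)

section \<open>Integrability and laws\<close>

lemma Lp_real_dominated:
  assumes "Y \<in> Lp_real M p" "X \<in> borel_measurable M" "AE \<omega> in M. \<bar>X \<omega>\<bar> \<le> \<bar>Y \<omega>\<bar>" "p \<ge> 0"
  shows "X \<in> Lp_real M p"
proof -
  have [measurable]: "X \<in> borel_measurable M" by fact
  have "integrable M (\<lambda>\<omega>. \<bar>X \<omega>\<bar> powr p)"
  proof (rule Bochner_Integration.integrable_bound)
    show "integrable M (\<lambda>\<omega>. \<bar>Y \<omega>\<bar> powr p)"
      using assms(1) by (simp add: Lp_real_def)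
    show "AE \<omega> in M. norm (\<bar>X \<omega>\<bar> powr p) \<le> norm (\<bar>Y \<omega>\<bar> powr p)"
      using assms(3) by eventually_elim (use assms(4) in \<open>auto intro: powr_mono2\<close>)
  qed measurable
  then show ?thesis
    using assms(2) by (simp add: Lp_real_def)
qed

lemma Lp_real_zero: "(\<lambda>_. 0) \<in> Lp_real M p"
  by (simp add: Lp_real_def)

lemma Lp_real_mult: "X \<in> Lp_real M p \<Longrightarrow> (\<lambda>\<omega>. c * X \<omega>) \<in> Lp_real M p"
  by (auto simp: Lp_real_def abs_mult powr_mult)

lemma Lp_real_abs: "X \<in> Lp_real M p \<Longrightarrow> (\<lambda>\<omega>. \<bar>X \<omega>\<bar>) \<in> Lp_real M p"
  by (auto simp: Lp_real_def)

lemma Lp_real_add: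
  assumes "X \<in> Lp_real M p" "Y \<in> Lp_real M p" "p \<ge> 0"
  shows "(\<lambda>\<omega>. X \<omega> + Y \<omega>) \<in> Lp_real M p"
proof -
  have [measurable]: "X \<in> borel_measurable M" "Y \<in> borel_measurable M"
    using assms by (auto simp: Lp_real_def)
  have bound: "\<bar>x + y\<bar> powr p \<le> 2 powr p * (\<bar>x\<bar> powr p + \<bar>y\<bar> powr p)" for x y :: real
  proof -
    have "\<bar>x + y\<bar> powr p \<le> (2 * max \<bar>x\<bar> \<bar>y\<bar>) powr p"
      using assms(3) by (intro powr_mono2) auto
    also have "\<dots> \<le> 2 powr p * (\<bar>x\<bar> powr p + \<bar>y\<bar> powr p)"
      by (auto simp: powr_mult max_def)
    finally show ?thesis .
  qed
  have "integrable M (\<lambda>\<omega>. \<bar>X \<omega> + Y \<omega>\<bar> powr p)"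
  proof (rule Bochner_Integration.integrable_bound)
    show "integrable M (\<lambda>\<omega>. 2 powr p * (\<bar>X \<omega>\<bar> powr p + \<bar>Y \<omega>\<bar> powr p))"
      using assms by (simp add: Lp_real_def)
  qed (use bound in auto)
  then show ?thesis
    by (simp add: Lp_real_def)
qed

lemma Lp_real_diff:
  assumes "X \<in> Lp_real M p" "Y \<in> Lp_real M p" "p \<ge> 0"
  shows "(\<lambda>\<omega>. X \<omega> - Y \<omega>) \<in> Lp_real M p"
  using Lp_real_add[OF assms(1) Lp_real_mult[OF assms(2), of "-1"] assms(3)] by simp

lemma Lp_real_sum:
  assumes "finite I" "\<And>i. i \<in> I \<Longrightarrow> X i \<in> Lp_real M p" "p \<ge> 0"
  shows "(\<lambda>\<omega>. \<Sum>i\<in>I. X i \<omega>) \<in> Lp_real M p"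
  using assms(1,2) by (induction rule: finite_induct) (auto simp: Lp_real_zero Lp_real_add assms(3))

section \<open>Random vectors through their coordinates\<close>

lemma measurable_Rborel_component:
  "i < k \<Longrightarrow> (\<lambda>x. x i) \<in> borel_measurable (Rborel k)"
  unfolding Rborel_def by simp

lemma measurable_Rborel_nth:
  "X \<in> measurable M (Rborel k) \<Longrightarrow> i < k \<Longrightarrow> (\<lambda>\<omega>. X \<omega> i) \<in> borel_measurable M"
  using measurable_compose[OF _ measurable_Rborel_component] by blast

lemma space_Rborel: "space (Rborel k) = Rvec k"
  by (simp add: Rborel_def Rvec_def space_PiM)

lemma measurable_RborelI:
  assumes "\<And>\<omega>. \<omega> \<in> space M \<Longrightarrow> X \<omega> \<in> Rvec k" "\<And>i. i < k \<Longrightarrow> (\<lambda>\<omega>. X \<omega> i) \<in> borel_measurable M"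
  shows "X \<in> measurable M (Rborel k)"
  unfolding Rborel_def by (rule measurable_PiM_single') (use assms in \<open>auto simp: Rvec_def\<close>)

lemma borel_measurable_vnorm:
  assumes "\<And>i. i < k \<Longrightarrow> (\<lambda>\<omega>. X \<omega> i) \<in> borel_measurable M"
  shows "(\<lambda>\<omega>. vnorm (ereal q) k (X \<omega>)) \<in> borel_measurable M"
proof -
  have "(\<lambda>\<omega>. \<Sum>i<k. \<bar>X \<omega> i\<bar> powr q) \<in> borel_measurable M"
  proof (intro borel_measurable_sum)
    fix i assume "i \<in> {..<k}"
    then have [measurable]: "(\<lambda>\<omega>. X \<omega> i) \<in> borel_measurable M"
      using assms by auto
    show "(\<lambda>\<omega>. \<bar>X \<omega> i\<bar> powr q) \<in> borel_measurable M"
      by measurable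
  qed
  then show ?thesis
    unfolding vnorm_real by measurable
qed

lemma vnorm_in_Lp_real:
  assumes "\<And>i. i < k \<Longrightarrow> (\<lambda>\<omega>. X \<omega> i) \<in> Lp_real M p" "a \<ge> 1" "p \<ge> 0"
  shows "(\<lambda>\<omega>. vnorm (ereal a) k (X \<omega>)) \<in> Lp_real M p"
proof (rule Lp_real_dominated)
  show "(\<lambda>\<omega>. \<Sum>i<k. \<bar>X \<omega> i\<bar>) \<in> Lp_real M p"
    using assms by (intro Lp_real_sum Lp_real_abs) auto
  show "(\<lambda>\<omega>. vnorm (ereal a) k (X \<omega>)) \<in> borel_measurable M"
    using assms(1) by (intro borel_measurable_vnorm) (auto simp: Lp_real_def)
qed (use assms vnorm_le_sum in \<open>auto simp: vnorm_nonneg sum_nonneg\<close>)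

text \<open>The norm lies between the absolute value of each coordinate and the sum of all of them,
  so integrability of vectors reduces to the closure properties of \<open>Lp_real\<close>.\<close>

lemma Lp_vec_iff:
  assumes "a \<ge> 1" "p \<ge> 0"
  shows "X \<in> Lp_vec M p a k \<longleftrightarrow>
    X \<in> measurable M (Rborel k) \<and> (\<forall>i<k. (\<lambda>\<omega>. X \<omega> i) \<in> Lp_real M p)"
proof safe
  assume X: "X \<in> Lp_vec M p a k"
  then show meas: "X \<in> measurable M (Rborel k)"
    by (simp add: Lp_vec_def)
  fix i assume "i < k"
  show "(\<lambda>\<omega>. X \<omega> i) \<in> Lp_real M p"
  proof (rule Lp_real_dominated)
    show "(\<lambda>\<omega>. vnorm (ereal a) k (X \<omega>)) \<in> Lp_real M p"
      using X measurable_Rborel_nth[OF meas] borel_measurable_vnorm[of k X M a]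
      by (auto simp: Lp_vec_def Lp_real_def vnorm_nonneg)
    show "(\<lambda>\<omega>. X \<omega> i) \<in> borel_measurable M"
      using measurable_Rborel_nth[OF meas] \<open>i < k\<close> by blast
  qed (use assms \<open>i < k\<close> in \<open>auto simp: abs_le_vnorm vnorm_nonneg\<close>)
next
  assume "X \<in> measurable M (Rborel k)" "\<forall>i<k. (\<lambda>\<omega>. X \<omega> i) \<in> Lp_real M p"
  then show "X \<in> Lp_vec M p a k"
    using vnorm_in_Lp_real[of k X M p a] assms by (auto simp: Lp_vec_def Lp_real_def vnorm_nonneg)
qed

lemma vdist_in_Lp_real:
  assumes "X \<in> Lp_vec M p a k" "Y \<in> Lp_vec M p a k" "a \<ge> 1" "p \<ge> 0"
  shows "(\<lambda>\<omega>. vdist a k (X \<omega>) (Y \<omega>)) \<in> Lp_real M p"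
  using assms by (intro vnorm_in_Lp_real Lp_real_diff) (auto simp: Lp_vec_iff)

text \<open>Couplings in the definition of the Wasserstein distance are only measurable with
  prescribed cdfs. This provides their integrability, without which the value of the cost integral
  would be meaningless.\<close>

lemma Lp_vec_distr_cong:
  assumes "X \<in> Lp_vec M p a k" "Y \<in> measurable M (Rborel k)"
    and "distr M (Rborel k) Y = distr M (Rborel k) X"
  shows "Y \<in> Lp_vec M p a k"
proof -
  let ?f = "\<lambda>x. vnorm (ereal a) k x powr p"
  have f: "?f \<in> borel_measurable (Rborel k)"
    using borel_measurable_vnorm[of k "\<lambda>x. x" "Rborel k" a] measurable_Rborel_component by measurable
  have X: "X \<in> measurable M (Rborel k)"
    using assms by (simp add: Lp_vec_def)
  have "integrable (distr M (Rborel k) X) ?f"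
    using assms(1) by (simp add: integrable_distr_eq[OF X f] Lp_vec_def)
  then show ?thesis
    using assms(2) by (simp add: assms(3)[symmetric] integrable_distr_eq[OF assms(2) f] Lp_vec_def)
qed

lemma Lp_real_distr_cong:
  assumes "X \<in> Lp_real M p" "Y \<in> borel_measurable M" "distr M borel Y = distr M borel X"
  shows "Y \<in> Lp_real M p"
proof -
  let ?f = "\<lambda>x::real. \<bar>x\<bar> powr p"
  have f: "?f \<in> borel_measurable borel"
    by measurable
  have X: "X \<in> borel_measurable M"
    using assms by (simp add: Lp_real_def)
  have "integrable (distr M borel X) ?f"
    using assms(1) by (simp add: integrable_distr_eq[OF X f] Lp_real_def)
  then show ?thesis
    using assms(2) by (simp add: assms(3)[symmetric] integrable_distr_eq[OF assms(2) f] Lp_real_def)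
qed

section \<open>Laws are determined by distribution functions\<close>

lemma (in prob_space) rcdf_eq_imp_distr_eq:
  assumes "X \<in> borel_measurable M" "Y \<in> borel_measurable M" "rcdf M X = rcdf M Y"
  shows "distr M borel X = distr M borel Y"
  using assms by (intro cdf_unique real_distribution_distr) auto

lemma sets_Rborel_half_spaces:
  "sets (Rborel k) = sigma_sets (Rvec k) ((\<lambda>x. PiE {..<k} (\<lambda>i. {..x i})) ` UNIV)"
  (is "_ = sigma_sets _ ?G")
proof
  have "?G \<subseteq> sets (Rborel k)"
    by (auto simp: Rborel_def intro!: sets_PiM_I_finite)
  then show "sigma_sets (Rvec k) ?G \<subseteq> sets (Rborel k)"
    using sets.sigma_sets_subset[of ?G "Rborel k"] by (simp add: space_Rborel)
next
  have sub: "?G \<subseteq> Pow (Rvec k)"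
    by (auto simp: Rvec_def)
  have "(\<lambda>x. x) \<in> measurable (sigma (Rvec k) ?G) (Rborel k)"
  proof (rule measurable_RborelI)
    fix i assume i: "i < k"
    have "{\<omega> \<in> space (sigma (Rvec k) ?G). \<omega> i \<le> c} \<in> sets (sigma (Rvec k) ?G)" for c
    proof -
      \<comment> \<open>A half-space in one coordinate is exhausted by lower orthants whose other
        bounds run through the natural numbers; half-spaces make the projections measurable.\<close>
      have "{\<omega> \<in> Rvec k. \<omega> i \<le> c} = (\<Union>N::nat. PiE {..<k} (\<lambda>j. {..(if j = i then c else real N)}))"
        (is "_ = ?U")
      proof safe
        fix \<omega> assume \<omega>: "\<omega> \<in> Rvec k" "\<omega> i \<le> c"
        obtain N :: nat where N: "(\<Sum>j<k. \<bar>\<omega> j\<bar>) \<le> real N"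
          using real_arch_simple by blast
        have "\<omega> j \<le> real N" if "j < k" for j
        proof -
          have "\<bar>\<omega> j\<bar> \<le> (\<Sum>j<k. \<bar>\<omega> j\<bar>)"
            by (rule member_le_sum[where f = "\<lambda>j. \<bar>\<omega> j\<bar>"]) (use that in auto)
          with N show ?thesis by linarith
        qed
        with \<omega> show "\<omega> \<in> ?U"
          by (auto simp: Rvec_def PiE_iff intro!: exI[of _ N])
      qed (use i in \<open>auto simp: Rvec_def PiE_iff split: if_splits\<close>)
      also have "\<dots> \<in> sigma_sets (Rvec k) ?G"
      proof -
        have "PiE {..<k} (\<lambda>j. {..(if j = i then c else real N)}) \<in> ?G" for N :: nat
          by (rule image_eqI[where x = "\<lambda>j. if j = i then c else real N"]) auto
        then show ?thesis
          by (intro sigma_sets.Union sigma_sets.Basic)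
      qed
      finally show ?thesis
        using sub by (simp add: space_measure_of sets_measure_of)
    qed
    then show "(\<lambda>\<omega>. \<omega> i) \<in> borel_measurable (sigma (Rvec k) ?G)"
      by (subst borel_measurable_iff_le) auto
  qed (use sub in \<open>simp add: space_measure_of\<close>)
  then show "sets (Rborel k) \<subseteq> sigma_sets (Rvec k) ?G"
    using measurable_sets[of "\<lambda>x. x" "sigma (Rvec k) ?G" "Rborel k"] sub sets.sets_into_space[of _ "Rborel k"]
    by (auto simp: space_measure_of sets_measure_of space_Rborel Int_absorb2)
qed

text \<open>Lower orthants generate the Borel sets, are closed under intersection (take the minimum
  of the corners in each coordinate) and exhaust the space, so two laws that agree on them are
  equal.\<close>

lemma (in prob_space) vcdf_eq_imp_distr_eq:
  assumes X: "X \<in> measurable M (Rborel k)" and Y: "Y \<in> measurable M (Rborel k)"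
    and eq: "vcdf M k X = vcdf M k Y"
  shows "distr M (Rborel k) X = distr M (Rborel k) Y"
proof (rule measure_eqI_generator_eq)
  let ?G = "(\<lambda>x. PiE {..<k} (\<lambda>i. {..x i})) ` UNIV :: (nat \<Rightarrow> real) set set"
  show "Int_stable ?G"
  proof (rule Int_stableI_image)
    fix x y :: "nat \<Rightarrow> real"
    show "\<exists>z\<in>UNIV. PiE {..<k} (\<lambda>i. {..x i}) \<inter> PiE {..<k} (\<lambda>i. {..y i}) = PiE {..<k} (\<lambda>i. {..z i})"
      by (rule bexI[of _ "\<lambda>i. min (x i) (y i)"]) (auto simp: PiE_Int)
  qed
  show "?G \<subseteq> Pow (Rvec k)"
    by (auto simp: Rvec_def)
  show "sets (distr M (Rborel k) X) = sigma_sets (Rvec k) ?G"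
    "sets (distr M (Rborel k) Y) = sigma_sets (Rvec k) ?G"
    by (simp_all add: sets_Rborel_half_spaces)
  show "range (\<lambda>N::nat. PiE {..<k} (\<lambda>i. {..real N})) \<subseteq> ?G"
    by auto
  show "(\<Union>N::nat. PiE {..<k} (\<lambda>i. {..real N})) = Rvec k"
  proof safe
    fix \<omega> assume \<omega>: "\<omega> \<in> Rvec k"
    obtain N :: nat where N: "(\<Sum>j<k. \<bar>\<omega> j\<bar>) \<le> real N"
      using real_arch_simple by blast
    have "\<omega> j \<le> real N" if "j < k" for j
    proof -
      have "\<bar>\<omega> j\<bar> \<le> (\<Sum>j<k. \<bar>\<omega> j\<bar>)"
        by (rule member_le_sum[where f = "\<lambda>j. \<bar>\<omega> j\<bar>"]) (use that in auto)
      with N show ?thesis by linarith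
    qed
    with \<omega> show "\<omega> \<in> (\<Union>N::nat. PiE {..<k} (\<lambda>i. {..real N}))"
      by (auto simp: Rvec_def PiE_iff)
  qed (auto simp: Rvec_def)
  interpret X: prob_space "distr M (Rborel k) X"
    using X by (rule prob_space_distr)
  show "emeasure (distr M (Rborel k) X) (PiE {..<k} (\<lambda>i. {..real N})) \<noteq> \<infinity>" for N :: nat
    by simp
  fix A assume "A \<in> ?G"
  then obtain x where A: "A = PiE {..<k} (\<lambda>i. {..x i})"
    by auto
  have "A \<in> sets (Rborel k)"
    unfolding A by (auto simp: Rborel_def intro!: sets_PiM_I_finite)
  then have "emeasure (distr M (Rborel k) Z) A = ennreal (vcdf M k Z x)"
    if Z: "Z \<in> measurable M (Rborel k)" for Z
  proof -
    have "Z -` A \<inter> space M = {\<omega>\<in>space M. \<forall>i<k. Z \<omega> i \<le> x i}"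
      using measurable_space[OF Z] by (auto simp: A space_Rborel Rvec_def PiE_iff)
    then show ?thesis
      using Z \<open>A \<in> sets (Rborel k)\<close> by (simp add: emeasure_distr vcdf_def emeasure_eq_measure)
  qed
  with X Y eq show "emeasure (distr M (Rborel k) X) A = emeasure (distr M (Rborel k) Y) A"
    by simp
qed

section \<open>Topology and Lipschitz bounds\<close>

lemma topspace_Rtop: "topspace (Rtop k) = Rvec k"
  by (simp add: Rtop_def Rvec_def)

lemma openin_Rtop_PiE: "(\<And>i. i < k \<Longrightarrow> open (A i)) \<Longrightarrow> openin (Rtop k) (PiE {..<k} A)"
  unfolding Rtop_def by (subst openin_PiE) (simp_all flip: open_openin)

text \<open>Max-norm balls are boxes of the product topology and hence open for every exponent.
  \<open>abs_le_vnorm\<close> and \<open>vdist_le_cube\<close> translate between them and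
  \<open>vdist\<close>.\<close>

definition open_cube :: "nat \<Rightarrow> (nat \<Rightarrow> real) \<Rightarrow> real \<Rightarrow> (nat \<Rightarrow> real) set" where
  "open_cube k x r = {y \<in> Rvec k. \<forall>i<k. \<bar>y i - x i\<bar> < r}"

lemma openin_open_cube: "openin (Rtop k) (open_cube k x r)"
proof -
  have "open_cube k x r = PiE {..<k} (\<lambda>i. {x i - r<..<x i + r})"
    by (rule set_eqI) (simp add: open_cube_def Rvec_def PiE_iff abs_diff_less_iff Ball_def conj_ac)
  then show ?thesis
    by (simp add: openin_Rtop_PiE)
qed

lemma openin_Rtop_PiE_D:
  assumes "openin (Rtop k) U" "x \<in> U"
  obtains A where "\<And>i. open (A i)" "x \<in> PiE {..<k} A" "PiE {..<k} A \<subseteq> U"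
  using product_topology_open_contains_basis[of "\<lambda>_. euclideanreal" "{..<k}" U x] assms
  by (auto simp: Rtop_def)

lemma open_contains_cube:
  assumes "openin (Rtop k) U" "x \<in> U"
  obtains r where "r > 0" "open_cube k x r \<subseteq> U"
proof -
  obtain A where A: "\<And>i. open (A i)" "x \<in> PiE {..<k} A" "PiE {..<k} A \<subseteq> U"
    using openin_Rtop_PiE_D[OF assms] by blast
  have "\<exists>e>0. \<forall>y. \<bar>y - x i\<bar> < e \<longrightarrow> y \<in> A i" if "i < k" for i
    using A(1)[of i] A(2) that by (auto simp: open_real PiE_iff)
  then obtain e where e: "\<And>i. i < k \<Longrightarrow> e i > 0"
    "\<And>i y. i < k \<Longrightarrow> \<bar>y - x i\<bar> < e i \<Longrightarrow> y \<in> A i"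
    by metis
  \<comment> \<open>The inserted 1 provides a radius when k = 0.\<close>
  define r where "r = Min (insert 1 (e ` {..<k}))"
  have "r > 0"
    using e(1) by (simp add: r_def)
  moreover have "r \<le> e i" if "i < k" for i
    unfolding r_def by (rule Min_le) (use that in auto)
  then have "y \<in> PiE {..<k} A" if "y \<in> open_cube k x r" for y
    using that e(2) by (force simp: open_cube_def Rvec_def PiE_iff)
  then have "open_cube k x r \<subseteq> U"
    using A(3) by blast
  ultimately show ?thesis
    using that by blast
qed

text \<open>Second countability in a form used three times: to see that open sets are Borel, to
  write the complement of a support as a countable union of null sets, and to separate points by a
  sequence of sets.\<close>

lemma countable_box_basis:
  obtains B where "countable B" "\<And>b. b \<in> B \<Longrightarrow> openin (Rtop k) b \<and> b \<in> sets (Rborel k)"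
    "\<And>U x. openin (Rtop k) U \<Longrightarrow> x \<in> U \<Longrightarrow> \<exists>b\<in>B. x \<in> b \<and> b \<subseteq> U"
proof -
  let ?Q = "PiE {..<k} (\<lambda>_. \<rat>) :: (nat \<Rightarrow> real) set"
  let ?b = "\<lambda>(l, u). PiE {..<k} (\<lambda>i. {l i<..<u i}) :: (nat \<Rightarrow> real) set"
  have "countable ?Q"
    by (rule countable_PiE) (simp_all add: countable_rat)
  then have "countable (?Q \<times> ?Q)"
    by simp
  then have 1: "countable (?b ` (?Q \<times> ?Q))"
    by (rule countable_image)
  have 2: "openin (Rtop k) b \<and> b \<in> sets (Rborel k)" if "b \<in> ?b ` (?Q \<times> ?Q)" for b
  proof -
    from that obtain q where "b = ?b q"
      by (rule imageE)
    then have b: "b = PiE {..<k} (\<lambda>i. {fst q i<..<snd q i})"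
      by (simp add: case_prod_beta)
    have "b \<in> sets (Rborel k)"
      unfolding b Rborel_def by (rule sets_PiM_I_finite) auto
    then show ?thesis
      unfolding b by (simp add: openin_Rtop_PiE)
  qed
  have 3: "\<exists>b\<in>?b ` (?Q \<times> ?Q). x \<in> b \<and> b \<subseteq> U" if U: "openin (Rtop k) U" "x \<in> U" for U x
  proof -
    from U obtain r where r: "r > 0" "open_cube k x r \<subseteq> U"
      using open_contains_cube by blast
    have "\<exists>q\<in>\<rat>. x i - r < q \<and> q < x i" "\<exists>q\<in>\<rat>. x i < q \<and> q < x i + r" for i
      using r(1) by (auto intro!: Rats_dense_in_real)
    then obtain l u where lu: "\<And>i. l i \<in> \<rat>" "\<And>i. x i - r < l i" "\<And>i. l i < x i"
      "\<And>i. u i \<in> \<rat>" "\<And>i. x i < u i" "\<And>i. u i < x i + r"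
      by metis
    have "x \<in> Rvec k"
      using openin_subset[OF U(1)] U(2) by (auto simp: topspace_Rtop)
    \<comment> \<open>Restricting the corners makes them extensional, so that they belong to the
      countable set \<open>?Q\<close> of rational points.\<close>
    then have "x \<in> ?b (restrict l {..<k}, restrict u {..<k})"
      using lu by (auto simp: Rvec_def PiE_iff)
    moreover have "?b (restrict l {..<k}, restrict u {..<k}) \<subseteq> open_cube k x r"
    proof
      fix y assume y: "y \<in> ?b (restrict l {..<k}, restrict u {..<k})"
      have "\<bar>y i - x i\<bar> < r" if "i < k" for i
      proof -
        have "l i < y i" "y i < u i"
          using y that by (auto simp: PiE_iff)
        then show ?thesis
          using lu(2,6)[of i] by (simp add: abs_less_iff)
      qed
      with y show "y \<in> open_cube k x r"
        by (auto simp: open_cube_def Rvec_def PiE_iff)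
    qed
    moreover have "?b (restrict l {..<k}, restrict u {..<k}) \<in> ?b ` (?Q \<times> ?Q)"
      using lu by (intro imageI) auto
    ultimately show ?thesis
      using r(2) by (meson subset_trans)
  qed
  show ?thesis
    by (rule that[OF 1 2 3])
qed

section \<open>Borel sets and supports\<close>

lemma openin_Rtop_imp_sets:
  assumes "openin (Rtop k) U"
  shows "U \<in> sets (Rborel k)"
proof -
  obtain B where B: "countable B" "\<And>b. b \<in> B \<Longrightarrow> openin (Rtop k) b \<and> b \<in> sets (Rborel k)"
    "\<And>U x. openin (Rtop k) U \<Longrightarrow> x \<in> U \<Longrightarrow> \<exists>b\<in>B. x \<in> b \<and> b \<subseteq> U"
    using countable_box_basis by blast
  have "U = \<Union>{b \<in> B. b \<subseteq> U}"
    using B(3)[OF assms] by blast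
  also have "\<dots> \<in> sets (Rborel k)"
    using B(1,2) by (intro sets.countable_Union) auto
  finally show ?thesis .
qed

text \<open>A point outside the support has a null neighbourhood and hence a null basis box around
  it; there are only countably many such boxes.\<close>

lemma (in prob_space) AE_in_support:
  assumes Z: "Z \<in> measurable M (Rborel k)"
  shows "AE \<omega> in M. Z \<omega> \<in> support M k Z"
proof -
  obtain B where B: "countable B" "\<And>b. b \<in> B \<Longrightarrow> openin (Rtop k) b \<and> b \<in> sets (Rborel k)"
    "\<And>U x. openin (Rtop k) U \<Longrightarrow> x \<in> U \<Longrightarrow> \<exists>b\<in>B. x \<in> b \<and> b \<subseteq> U"
    using countable_box_basis by blast
  let ?N = "{b \<in> B. prob {\<omega>\<in>space M. Z \<omega> \<in> b} = 0}"
  have meas: "{\<omega>\<in>space M. Z \<omega> \<in> U} \<in> events" if "openin (Rtop k) U" for U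
    using measurable_sets[OF Z openin_Rtop_imp_sets[OF that]] by (simp add: vimage_def Int_def conj_commute)
  have "AE \<omega> in M. \<forall>b\<in>?N. Z \<omega> \<notin> b"
  proof (subst AE_ball_countable)
    show "countable ?N"
      using B(1) by (rule countable_subset[rotated]) auto
    show "\<forall>b\<in>?N. AE \<omega> in M. Z \<omega> \<notin> b"
    proof
      fix b assume b: "b \<in> ?N"
      have "{\<omega>\<in>space M. Z \<omega> \<in> b} \<in> events"
        using b B(2) by (intro meas) auto
      with b show "AE \<omega> in M. Z \<omega> \<notin> b"
        by (subst AE_iff_measurable) (auto simp: emeasure_eq_measure)
    qed
  qed
  then show ?thesis
  proof (rule AE_mp, intro AE_I2 impI)
    fix \<omega> assume \<omega>: "\<omega> \<in> space M" "\<forall>b\<in>?N. Z \<omega> \<notin> b"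
    show "Z \<omega> \<in> support M k Z"
      unfolding support_def
    proof safe
      show "Z \<omega> \<in> Rvec k"
        using measurable_space[OF Z \<omega>(1)] by (simp add: space_Rborel)
      fix U assume U: "openin (Rtop k) U" "Z \<omega> \<in> U"
      then obtain b where b: "b \<in> B" "Z \<omega> \<in> b" "b \<subseteq> U"
        using B(3) by blast
      with \<omega>(2) have "0 < prob {\<omega>\<in>space M. Z \<omega> \<in> b}"
        by (auto simp: less_le)
      also have "\<dots> \<le> prob {\<omega>\<in>space M. Z \<omega> \<in> U}"
        using b(3) meas[OF U(1)] by (intro finite_measure_mono) auto
      finally show "0 < prob {\<omega>\<in>space M. Z \<omega> \<in> U}" .
    qed
  qed
qed

lemma closed_imp_sets_Rborel:
  assumes "closedin (Rtop k) C"
  shows "C \<in> sets (Rborel k)"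
proof -
  have "C = space (Rborel k) - (topspace (Rtop k) - C)"
    using closedin_subset[OF assms] by (auto simp: space_Rborel topspace_Rtop)
  also have "\<dots> \<in> sets (Rborel k)"
    using assms by (intro sets.compl_sets openin_Rtop_imp_sets) (auto simp: closedin_def)
  finally show ?thesis .
qed

lemma compactin_Rtop_imp_closedin: "compactin (Rtop k) C \<Longrightarrow> closedin (Rtop k) C"
  by (rule compactin_imp_closedin) (auto simp: Rtop_def Hausdorff_space_product_topology)

section \<open>Locally Lipschitz functions and smallest Lipschitz constants\<close>

lemma vdist_le_cube:
  assumes "a \<ge> 1" "y \<in> open_cube k x r"
  shows "vdist a k y x \<le> real k * r"
proof -
  have "vdist a k y x \<le> (\<Sum>i<k. \<bar>y i - x i\<bar>)"
    using assms(1) by (rule vnorm_le_sum)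
  also have "\<dots> \<le> (\<Sum>i<k. r)"
    using assms(2) by (intro sum_mono) (auto simp: open_cube_def less_imp_le)
  finally show ?thesis by simp
qed

lemma locally_lipschitz_measurable:
  assumes "locally_lipschitz a k f" "a \<ge> 1"
  shows "f \<in> borel_measurable (Rborel k)"
proof -
  have open_less: "openin (Rtop k) {x \<in> Rvec k. h x < c}" if h: "locally_lipschitz a k h" for h and c :: real
  proof (subst openin_subopen, intro ballI)
    fix x assume "x \<in> {x \<in> Rvec k. h x < c}"
    then have x: "x \<in> Rvec k" "h x < c"
      by auto
    then obtain U L where U: "openin (Rtop k) U" "x \<in> U" "lipschitz_bound a k U h L"
      using h by (auto simp: locally_lipschitz_def)
    then have L: "L \<ge> 0"
      by (simp add: lipschitz_bound_def)
    \<comment> \<open>On the cube \<open>h\<close> changes by at most \<open>L * real k * r\<close>.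
      The summand 1 keeps the denominator positive and makes this change strictly smaller than
      \<open>c - h x\<close>.\<close>
    define r where "r = (c - h x) / (L * real k + 1)"
    have pos: "L * real k + 1 > 0"
      using L by (simp add: add_nonneg_pos)
    then have r: "r > 0" "L * real k * r < c - h x"
      using x(2) by (auto simp: r_def field_simps)
    have "h y < c" if y: "y \<in> U \<inter> open_cube k x r" for y
    proof -
      have "\<bar>h y - h x\<bar> \<le> L * vdist a k y x"
        using U(2,3) y by (auto simp: lipschitz_bound_def)
      also have "\<dots> \<le> L * (real k * r)"
        using vdist_le_cube[OF assms(2), of y k x r] y L by (intro mult_left_mono) auto
      finally show ?thesis
        using r(2) by (simp add: mult.assoc)
    qed
    moreover have "x \<in> open_cube k x r"
      using x r by (simp add: open_cube_def)
    ultimately show "\<exists>T. openin (Rtop k) T \<and> x \<in> T \<and> T \<subseteq> {x \<in> Rvec k. h x < c}"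
      using U openin_open_cube[of k x r] by (intro exI[of _ "U \<inter> open_cube k x r"]) (auto simp: open_cube_def)
  qed
  show ?thesis
    by (subst borel_measurable_iff_less)
       (auto simp: space_Rborel intro!: openin_Rtop_imp_sets open_less assms(1))
qed

text \<open>C may fail to be convex, so local constants cannot be chained along segments. Instead a
  Lebesgue number \<delta> of a finite cover splits the pairs: points closer than \<delta> share a
  cube on which a local constant applies, and for points further apart a bound D of |f| on C gives
  the quotient 2D/\<delta>.\<close>

lemma locally_lipschitz_on_compact:
  assumes "locally_lipschitz a k f" "a \<ge> 1" "compactin (Rtop k) C"
  obtains L where "lipschitz_bound a k C f L"
proof -
  have C: "C \<subseteq> Rvec k"
    using compactin_subset_topspace[OF assms(3)] by (simp add: topspace_Rtop)
  \<comment> \<open>Doubling leaves room: a point within \<open>r\<close> of a point of the small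
    cube still lies in the large one, where the local bound holds.\<close>
  have "\<exists>r L. r > 0 \<and> lipschitz_bound a k (open_cube k x (2 * r)) f L" if "x \<in> C" for x
  proof -
    have "x \<in> Rvec k"
      using that C by blast
    then obtain U L where U: "openin (Rtop k) U" "x \<in> U" "lipschitz_bound a k U f L"
      using assms(1) unfolding locally_lipschitz_def by blast
    then obtain r where r: "r > 0" "open_cube k x r \<subseteq> U"
      using open_contains_cube by blast
    then have "lipschitz_bound a k (open_cube k x (2 * (r / 2))) f L"
      using U(3) unfolding lipschitz_bound_def by auto
    with r(1) show ?thesis
      by (intro exI[of _ "r / 2"] exI[of _ L] conjI) simp_all
  qed
  then obtain r L where rL: "\<And>x. x \<in> C \<Longrightarrow> r x > 0"
    "\<And>x. x \<in> C \<Longrightarrow> lipschitz_bound a k (open_cube k x (2 * r x)) f (L x)"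
    by metis
  have "\<exists>\<F>. finite \<F> \<and> \<F> \<subseteq> (\<lambda>x. open_cube k x (r x)) ` C \<and> C \<subseteq> \<Union>\<F>"
  proof (rule compactinD[OF assms(3)])
    have "x \<in> open_cube k x (r x)" if "x \<in> C" for x
      using C rL(1) that by (auto simp: open_cube_def)
    then show "C \<subseteq> \<Union>((\<lambda>x. open_cube k x (r x)) ` C)"
      by blast
    show "openin (Rtop k) U" if "U \<in> (\<lambda>x. open_cube k x (r x)) ` C" for U
      using that openin_open_cube by blast
  qed
  then obtain \<F> where \<F>: "finite \<F>" "\<F> \<subseteq> (\<lambda>x. open_cube k x (r x)) ` C" "C \<subseteq> \<Union>\<F>"
    by blast
  obtain F where F: "F \<subseteq> C" "finite F" "C \<subseteq> (\<Union>x\<in>F. open_cube k x (r x))"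
    using finite_subset_image[OF \<F>(1,2)] \<F>(3) by blast
  \<comment> \<open>The inserted 1 covers the case of an empty C, where F may be empty.\<close>
  define \<delta> where "\<delta> = Min (insert 1 (r ` F))"
  \<comment> \<open>On one cube |f| is at most its value at the centre plus the largest change over
    the cube; the sum dominates these bounds for all centres.\<close>
  define D where "D = (\<Sum>x\<in>F. \<bar>f x\<bar> + L x * (real k * r x))"
  have \<delta>: "\<delta> > 0" "\<And>x. x \<in> F \<Longrightarrow> \<delta> \<le> r x"
    using F rL(1) by (auto simp: \<delta>_def)
  have L0: "L x \<ge> 0" if "x \<in> F" for x
    using rL(2) that F(1) by (auto simp: lipschitz_bound_def)
  have nonneg: "0 \<le> \<bar>f x\<bar> + L x * (real k * r x)" if "x \<in> F" for x
    using L0[OF that] rL(1)[of x] F(1) that by (auto intro!: add_nonneg_nonneg mult_nonneg_nonneg)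
  then have D0: "D \<ge> 0"
    unfolding D_def by (rule sum_nonneg)
  have D: "\<bar>f y\<bar> \<le> D" if y: "y \<in> C" for y
  proof -
    obtain x where x: "x \<in> F" "y \<in> open_cube k x (r x)"
      using F(3) y by blast
    then have "x \<in> C" "r x > 0"
      using F(1) rL(1) by auto
    then have "\<bar>f y - f x\<bar> \<le> L x * vdist a k y x"
      using rL(2)[of x] x C unfolding lipschitz_bound_def open_cube_def by force
    also have "\<dots> \<le> L x * (real k * r x)"
      using vdist_le_cube[OF assms(2) x(2)] L0[OF x(1)] by (intro mult_left_mono)
    finally have "\<bar>f y\<bar> \<le> \<bar>f x\<bar> + L x * (real k * r x)"
      by linarith
    also have "\<dots> \<le> D"
      unfolding D_def by (rule member_le_sum[where f = "\<lambda>x. \<bar>f x\<bar> + L x * (real k * r x)"])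
        (use x nonneg F in auto)
    finally show ?thesis .
  qed
  let ?L = "2 * D / \<delta> + sum L F"
  have sumL: "sum L F \<ge> 0"
    using L0 by (rule sum_nonneg)
  have "\<bar>f y - f z\<bar> \<le> ?L * vdist a k y z" if yz: "y \<in> C" "z \<in> C" for y z
  proof (cases "vdist a k y z < \<delta>")
    case True
    obtain x where x: "x \<in> F" "y \<in> open_cube k x (r x)"
      using F(3) yz(1) by blast
    have rx: "r x > 0"
      using x F(1) rL(1) by auto
    have "\<bar>z i - x i\<bar> < 2 * r x" if i: "i < k" for i
    proof -
      have "\<bar>y i - z i\<bar> \<le> vdist a k y z"
        using abs_le_vnorm[of a i k "\<lambda>i. y i - z i"] assms(2) i by simp
      with True \<delta>(2)[OF x(1)] have "\<bar>y i - z i\<bar> < r x"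
        by linarith
      moreover have "\<bar>y i - x i\<bar> < r x"
        using x(2) i by (simp add: open_cube_def)
      ultimately show "\<bar>z i - x i\<bar> < 2 * r x"
        by linarith
    qed
    then have "z \<in> open_cube k x (2 * r x)"
      using yz C by (auto simp: open_cube_def)
    moreover have "y \<in> open_cube k x (2 * r x)"
      using x(2) rx unfolding open_cube_def by force
    ultimately have "\<bar>f y - f z\<bar> \<le> L x * vdist a k y z"
      using rL(2)[of x] x(1) F(1) by (auto simp: lipschitz_bound_def)
    also have "L x \<le> ?L"
      using member_le_sum[of x F L] x(1) L0 F(2) D0 \<delta>(1) by (simp add: add_increasing)
    finally show ?thesis
      by (meson mult_right_mono vnorm_nonneg order_trans \<open>L x \<le> ?L\<close>)
  next
    case False
    have "\<bar>f y - f z\<bar> \<le> 2 * D"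
      using D[OF yz(1)] D[OF yz(2)] by linarith
    also have "\<dots> = 2 * D / \<delta> * \<delta>"
      using \<delta>(1) by simp
    also have "\<dots> \<le> ?L * vdist a k y z"
      using False \<delta>(1) D0 sumL by (intro mult_mono) auto
    finally show ?thesis .
  qed
  moreover have "?L \<ge> 0"
    using D0 \<delta>(1) sumL by simp
  ultimately have "lipschitz_bound a k C f ?L"
    by (auto simp: lipschitz_bound_def)
  then show ?thesis
    using that by blast
qed

text \<open>Every admissible constant dominates each difference quotient, so their infimum does as
  well. At distance zero a single admissible constant already forces equal values.\<close>

lemma lipschitz_bound_constant:
  assumes "lipschitz_bound a k S f L"
  shows "lipschitz_bound a k S f (lipschitz_constant a k S f)"
proof -
  let ?B = "{L. lipschitz_bound a k S f L}"
  have ne: "?B \<noteq> {}"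
    using assms by blast
  have "\<bar>f x - f y\<bar> \<le> Inf ?B * vdist a k x y" if xy: "x \<in> S" "y \<in> S" for x y
  proof (cases "vdist a k x y = 0")
    case True
    moreover have "\<bar>f x - f y\<bar> \<le> L * vdist a k x y"
      using assms xy by (simp add: lipschitz_bound_def)
    ultimately show ?thesis
      by simp
  next
    case False
    then have pos: "vdist a k x y > 0"
      using vnorm_nonneg[of "ereal a" k "\<lambda>i. x i - y i"] by linarith
    have "\<bar>f x - f y\<bar> / vdist a k x y \<le> Inf ?B"
      using ne pos xy by (intro cInf_greatest) (auto simp: lipschitz_bound_def divide_le_eq)
    with pos show ?thesis
      by (simp add: divide_le_eq)
  qed
  moreover have "0 \<le> Inf ?B"
    using ne by (intro cInf_greatest) (auto simp: lipschitz_bound_def)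
  ultimately show ?thesis
    by (auto simp: lipschitz_bound_def lipschitz_constant_def)
qed

lemma lipschitz_constant_le:
  assumes "lipschitz_bound a k S f L"
  shows "lipschitz_constant a k S f \<le> L"
  unfolding lipschitz_constant_def
  by (rule cInf_lower) (use assms in \<open>auto simp: lipschitz_bound_def intro!: bdd_belowI[of _ 0]\<close>)

text \<open>The block distances u and v satisfy u^a + v^a = w^a for the full distance w. Hence u, v
  <= w, which gives the sum L + B, and u + v <= 2^(1/b) w, which gives the bound with the
  maximum.\<close>

lemma block_lipschitz_bounds:
  fixes a :: real and b :: ereal
  assumes ab: "a \<ge> 1" "b \<ge> 1" "1 / ereal a + 1 / b = 1" and "m \<le> n"
    and g: "\<forall>x\<in>Rvec n. g x = g' (block1 m x) + (\<Sum>i<n - m. \<beta> i * block2 m n x i)"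
    and L: "lipschitz_bound a m C g' L"
  defines "S \<equiv> {x\<in>Rvec n. block1 m x \<in> C}" and "B \<equiv> vnorm b (n - m) \<beta>"
  shows "lipschitz_bound a n S g (L + B)"
    and "lipschitz_bound a n S g (real n powr real_of_ereal (1 / b) * max L B)"
proof -
  have pos: "L \<ge> 0" "B \<ge> 0"
    using L by (auto simp: lipschitz_bound_def B_def vnorm_nonneg)
  let ?u = "\<lambda>x y. vdist a m x y" and ?v = "\<lambda>x y. vnorm (ereal a) (n - m) (\<lambda>i. x (m + i) - y (m + i))"
  have bound: "\<bar>g x - g y\<bar> \<le> L * ?u x y + B * ?v x y" if "x \<in> S" "y \<in> S" for x y
  proof -
    let ?D = "\<Sum>i<n - m. \<beta> i * (x (m + i) - y (m + i))"
    have "g x - g y = (g' (block1 m x) - g' (block1 m y)) + ?D"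
      using that g by (simp add: S_def block2_def right_diff_distrib sum_subtractf)
    then have "\<bar>g x - g y\<bar> \<le> \<bar>g' (block1 m x) - g' (block1 m y)\<bar> + \<bar>?D\<bar>"
      by linarith
    also have "\<bar>g' (block1 m x) - g' (block1 m y)\<bar> \<le> L * vdist a m (block1 m x) (block1 m y)"
      using L that by (auto simp: lipschitz_bound_def S_def)
    also have "vdist a m (block1 m x) (block1 m y) = ?u x y"
      by (rule vnorm_cong) (simp add: block1_def)
    also have "\<bar>?D\<bar> \<le> B * ?v x y"
      unfolding B_def by (rule Hoelder_sum[OF ab])
    finally show ?thesis by simp
  qed
  have powr_uv: "?u x y powr a + ?v x y powr a = vdist a n x y powr a" for x y
    using vnorm_blocks[of m n a "\<lambda>i. x i - y i"] ab(1) \<open>m \<le> n\<close> by simp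
  have root: "u \<le> w" if "u powr a \<le> w powr a" "u \<ge> 0" "w \<ge> 0" for u w :: real
    using powr_mono2[of "1 / a" "u powr a" "w powr a"] that ab(1) by (simp add: powr_powr)
  have uv: "?u x y \<le> vdist a n x y" "?v x y \<le> vdist a n x y" for x y
    by (rule root; simp add: vnorm_nonneg flip: powr_uv)+
  have "L * ?u x y + B * ?v x y \<le> (L + B) * vdist a n x y" for x y
    using uv[of x y] pos by (simp add: distrib_right add_mono mult_left_mono)
  with bound have "\<bar>g x - g y\<bar> \<le> (L + B) * vdist a n x y" if "x \<in> S" "y \<in> S" for x y
    using that order_trans by blast
  with pos show "lipschitz_bound a n S g (L + B)"
    by (simp add: lipschitz_bound_def)
  let ?c = "real n powr real_of_ereal (1 / b)"
  have sum_uv: "?u x y + ?v x y \<le> ?c * vdist a n x y" for x y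
  proof -
    \<comment> \<open>The factor 2^(1/b) from two blocks is dominated by n^(1/b) only from n = 2 on;
      below that at most one block is nonempty.\<close>
    consider "n = 0" | "n = 1" | "n \<ge> 2" by linarith
    then show ?thesis
    proof cases
      case 1
      then show ?thesis
        using \<open>m \<le> n\<close> by (simp add: vnorm_zero)
    next
      case 2
      then have "m = 0 \<or> n - m = 0"
        using \<open>m \<le> n\<close> by auto
      then have "?u x y = 0 \<or> ?v x y = 0"
        by (auto intro!: vnorm_zero)
      then show ?thesis
        using uv[of x y] 2 by auto
    next
      case 3
      have "?u x y + ?v x y \<le> 2 powr real_of_ereal (1 / b) * (?u x y powr a + ?v x y powr a) powr (1 / a)"
        by (rule add_le_vnorm_2[OF ab]) (auto simp: vnorm_nonneg)
      also have "\<dots> = 2 powr real_of_ereal (1 / b) * vdist a n x y"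
        using ab(1) by (simp add: powr_uv powr_powr vnorm_nonneg)
      also have "0 \<le> real_of_ereal (1 / b)"
        using ab by (cases rule: conjugate_exponents_cases) (auto simp: one_ereal_def)
      then have "2 powr real_of_ereal (1 / b) * vdist a n x y \<le> ?c * vdist a n x y"
        using 3 by (intro mult_right_mono powr_mono2 vnorm_nonneg) auto
      finally show ?thesis .
    qed
  qed
  have "L * ?u x y + B * ?v x y \<le> ?c * max L B * vdist a n x y" for x y
  proof -
    have "L * ?u x y + B * ?v x y \<le> max L B * ?u x y + max L B * ?v x y"
      by (intro add_mono mult_right_mono vnorm_nonneg) auto
    also have "\<dots> = max L B * (?u x y + ?v x y)"
      by (simp add: distrib_left)
    also have "\<dots> \<le> max L B * (?c * vdist a n x y)"
      using sum_uv pos by (intro mult_left_mono) auto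
    finally show ?thesis by (simp add: ac_simps)
  qed
  with bound have "\<bar>g x - g y\<bar> \<le> ?c * max L B * vdist a n x y" if "x \<in> S" "y \<in> S" for x y
    using that order_trans by blast
  moreover have "0 \<le> ?c * max L B"
    using pos by simp
  ultimately show "lipschitz_bound a n S g (?c * max L B)"
    by (simp add: lipschitz_bound_def)
qed

section \<open>Comonotone couplings\<close>

lemma nn_integral_powr_from:
  fixes p :: real
  assumes "p \<ge> 1" "y \<le> x"
  shows "(\<integral>\<^sup>+t. ennreal (indicator {y..x} t * (p * (t - y) powr (p - 1))) \<partial>lborel) = ennreal ((x - y) powr p)"
proof -
  have "((\<lambda>s. p * s powr (p - 1)) has_integral (x - y) powr p) {0..x - y}"
    using has_integral_mult_right[OF has_integral_powr_from_0[of "p - 1" "x - y"], of p] assms by simp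
  then have "(\<integral>\<^sup>+s. ennreal (indicator {0..x - y} s * (p * s powr (p - 1))) \<partial>lborel) = ennreal ((x - y) powr p)"
    using assms by (intro nn_integral_has_integral_lebesgue) auto
  moreover have "(\<integral>\<^sup>+t. ennreal (indicator {y..x} t * (p * (t - y) powr (p - 1))) \<partial>lborel)
     = (\<integral>\<^sup>+s. ennreal (indicator {0..x - y} s * (p * s powr (p - 1))) \<partial>lborel)"
    by (subst nn_integral_real_affine[where c = 1 and t = y])
       (auto intro!: nn_integral_cong simp: indicator_def)
  ultimately show ?thesis by simp
qed

text \<open>The point \<open>z = (t, u)\<close> lies in the planar region under the graph of p (t -
  y)^(p-1) over y < t <= x, whose area is (x - y)^p when y <= x. A region in place of a weighted
  half-line turns the expected cost into an integral of probabilities.\<close>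

definition layer :: "real \<Rightarrow> real \<Rightarrow> real \<Rightarrow> real \<times> real \<Rightarrow> bool" where
  "layer p x y z \<longleftrightarrow>
     fst z \<le> x \<and> y < fst z \<and> 0 \<le> snd z \<and> snd z < p * (fst z - y) powr (p - 1)"

lemma layer_measurable [measurable]:
  assumes [measurable]: "X \<in> borel_measurable M" "Y \<in> borel_measurable M" "Z \<in> borel_measurable M"
  shows "Measurable.pred M (\<lambda>\<omega>. layer p (X \<omega>) (Y \<omega>) (Z \<omega>))"
proof -
  have "Z \<in> measurable M (borel \<Otimes>\<^sub>M borel)"
    using assms(3) by (simp add: borel_prod)
  then have [measurable]: "(\<lambda>\<omega>. fst (Z \<omega>)) \<in> borel_measurable M" "(\<lambda>\<omega>. snd (Z \<omega>)) \<in> borel_measurable M"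
    by measurable
  show ?thesis
    unfolding layer_def by measurable
qed

text \<open>
  The positive part of the cost is a mixture of indicators that are increasing in one argument and
  decreasing in the other, so that it suffices to compare couplings on products of half-lines.
\<close>

lemma nn_integral_layer:
  fixes p :: real
  assumes "p \<ge> 1"
  shows "(\<integral>\<^sup>+z. (if layer p x y z then 1 else 0) \<partial>lborel) = ennreal (max 0 (x - y) powr p)"
proof -
  have "(\<integral>\<^sup>+z. (if layer p x y z then 1 else 0) \<partial>lborel) =
     (\<integral>\<^sup>+z. (if layer p x y z then 1 else 0) \<partial>(lborel \<Otimes>\<^sub>M lborel :: (real \<times> real) measure))"
    by (simp add: lborel_prod)
  also have "\<dots> = (\<integral>\<^sup>+t. (\<integral>\<^sup>+u. (if layer p x y (t, u) then 1 else 0) \<partial>lborel) \<partial>lborel)"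
  proof (rule lborel.nn_integral_fst[symmetric])
    have "(\<lambda>z. z) \<in> measurable (lborel \<Otimes>\<^sub>M lborel) (borel :: (real \<times> real) measure)"
      by (simp add: lborel_prod)
    then show "(\<lambda>z. if layer p x y z then 1 else 0) \<in> borel_measurable (lborel \<Otimes>\<^sub>M lborel)"
      by measurable
  qed
  also have "\<dots> = (\<integral>\<^sup>+t. ennreal (indicator {y..x} t * (p * (t - y) powr (p - 1))) \<partial>lborel)"
  proof (rule nn_integral_cong)
    fix t :: real
    \<comment> \<open>At \<open>t = y\<close> the strict inequality in \<open>layer\<close> agrees
      with the convention \<open>0 powr 0 = 0\<close>, so the slices match pointwise even for p =
      1.\<close>
    let ?c = "indicator {y..x} t * (p * (t - y) powr (p - 1))"
    have "(\<integral>\<^sup>+u. (if layer p x y (t, u) then 1 else 0) \<partial>lborel) = (\<integral>\<^sup>+u. indicator {0..<?c} u \<partial>lborel)"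
      by (rule nn_integral_cong) (auto simp: layer_def indicator_def not_less le_less)
    also have "\<dots> = ennreal ?c"
      using assms by simp
    finally show "(\<integral>\<^sup>+u. (if layer p x y (t, u) then 1 else 0) \<partial>lborel) = ennreal ?c" .
  qed
  also have "\<dots> = ennreal (max 0 (x - y) powr p)"
  proof (cases "y \<le> x")
    case True
    with nn_integral_powr_from[OF assms] show ?thesis
      by simp
  qed simp
  finally show ?thesis .
qed

text \<open>Strict order on one side and weak order on the other leave ties free, so that Y may vary
  on an atom of X; by contraposition the relation is still symmetric. The set A allows for a null
  set off which the quantile transform is monotone.\<close>

definition comonotone_on :: "'w set \<Rightarrow> ('w \<Rightarrow> real) \<Rightarrow> ('w \<Rightarrow> real) \<Rightarrow> bool" where
  "comonotone_on A X Y \<longleftrightarrow> (\<forall>\<omega>\<in>A. \<forall>\<omega>'\<in>A. X \<omega> < X \<omega>' \<longrightarrow> Y \<omega> \<le> Y \<omega>')"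

lemma comonotone_on_commute: "comonotone_on A X Y \<Longrightarrow> comonotone_on A Y X"
  unfolding comonotone_on_def by (meson not_le order.strict_trans1 less_irrefl)

section \<open>Comonotone couplings minimise the cost\<close>

context prob_space
begin

lemma prob_cong_distr:
  assumes "X \<in> borel_measurable M" "X' \<in> borel_measurable M" "distr M borel X = distr M borel X'"
    and "B \<in> sets borel"
  shows "prob {\<omega>\<in>space M. X \<omega> \<in> B} = prob {\<omega>\<in>space M. X' \<omega> \<in> B}"
proof -
  have "prob {\<omega>\<in>space M. f \<omega> \<in> B} = measure (distr M borel f) B" if "f \<in> borel_measurable M" for f
    using that assms(4) by (simp add: measure_distr vimage_def Int_def conj_commute)
  from this[OF assms(1)] this[OF assms(2)] show ?thesis
    by (simp only: assms(3))
qed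

text \<open>A comonotone pair attains the lower Frechet bound max(0, P(X in U) + P(Y in D) - 1).
  Either the two events do not meet on A and their intersection is null, or a common point exists
  and their union has full measure.\<close>

lemma comonotone_prob_le:
  assumes meas [measurable]: "X \<in> borel_measurable M" "Y \<in> borel_measurable M"
      "X' \<in> borel_measurable M" "Y' \<in> borel_measurable M"
    and law: "distr M borel X' = distr M borel X" "distr M borel Y' = distr M borel Y"
    and A: "AE \<omega> in M. \<omega> \<in> A" "comonotone_on A X Y"
    and up: "\<And>x x'. x \<in> U \<Longrightarrow> x \<le> x' \<Longrightarrow> x' \<in> U" and down: "\<And>y y'. y \<in> D \<Longrightarrow> y' \<le> y \<Longrightarrow> y' \<in> D"
    and [measurable]: "U \<in> sets borel" "D \<in> sets borel"
  shows "prob {\<omega>\<in>space M. X \<omega> \<in> U \<and> Y \<omega> \<in> D} \<le> prob {\<omega>\<in>space M. X' \<omega> \<in> U \<and> Y' \<omega> \<in> D}"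
proof -
  let ?P = "{\<omega>\<in>space M. X \<omega> \<in> U}" and ?Q = "{\<omega>\<in>space M. Y \<omega> \<in> D}"
  let ?P' = "{\<omega>\<in>space M. X' \<omega> \<in> U}" and ?Q' = "{\<omega>\<in>space M. Y' \<omega> \<in> D}"
  have inter: "{\<omega>\<in>space M. X \<omega> \<in> U \<and> Y \<omega> \<in> D} = ?P \<inter> ?Q"
    "{\<omega>\<in>space M. X' \<omega> \<in> U \<and> Y' \<omega> \<in> D} = ?P' \<inter> ?Q'"
    by auto
  have incl_excl: "prob (S \<inter> T) = prob S + prob T - prob (S \<union> T)" if "S \<in> events" "T \<in> events" for S T
    using measure_Un3[of S M T] that by (simp add: fmeasurable_eq_sets)
  show ?thesis
  proof (cases "A \<inter> (?P \<inter> ?Q) = {}")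
    case True
    then have "\<omega> \<notin> ?P \<inter> ?Q" if "\<omega> \<in> A" for \<omega>
      using that by blast
    then have "AE \<omega> in M. \<omega> \<notin> ?P \<inter> ?Q"
      by (rule eventually_mono[OF A(1)])
    moreover have "?P \<inter> ?Q \<in> events"
      by measurable
    ultimately have "prob (?P \<inter> ?Q) = 0"
      by (simp only: prob_eq_0)
    then show ?thesis
      unfolding inter by simp
  next
    case False
    then obtain \<omega>0 where \<omega>0: "\<omega>0 \<in> A" "X \<omega>0 \<in> U" "Y \<omega>0 \<in> D"
      by auto
    \<comment> \<open>A sample point with Y outside the down-set D lies strictly above \<omega>0 in
      Y, so comonotonicity keeps it from lying strictly below in X, and the up-set U contains its
      value.\<close>
    have cover: "\<omega> \<in> ?P \<union> ?Q" if \<omega>: "\<omega> \<in> A" "\<omega> \<in> space M" for \<omega>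
    proof (cases "Y \<omega> \<in> D")
      case False
      then have "\<not> Y \<omega> \<le> Y \<omega>0"
        using down \<omega>0(3) by blast
      then have "X \<omega>0 \<le> X \<omega>"
        using A(2) \<omega>(1) \<omega>0(1) by (auto simp: comonotone_on_def not_less[symmetric])
      then show ?thesis
        using up \<omega>0(2) \<omega>(2) by blast
    qed (use \<omega> in auto)
    have "AE \<omega> in M. \<omega> \<in> ?P \<union> ?Q"
    proof (rule AE_mp[OF A(1)], rule AE_I2, rule impI)
      show "\<omega> \<in> ?P \<union> ?Q" if "\<omega> \<in> space M" "\<omega> \<in> A" for \<omega>
        using that(2,1) by (rule cover)
    qed
    moreover have "?P \<in> events" "?Q \<in> events"
      by measurable
    ultimately have "prob (?P \<union> ?Q) = 1"
      using prob_eq_1[OF sets.Un[of ?P M ?Q]] by blast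
    moreover have "prob ?P = prob ?P'"
      by (rule prob_cong_distr) (use law in simp_all)
    moreover have "prob ?Q = prob ?Q'"
      by (rule prob_cong_distr) (use law in simp_all)
    ultimately show ?thesis
      unfolding inter using incl_excl[of ?P ?Q] incl_excl[of ?P' ?Q'] prob_le_1[of "?P' \<union> ?Q'"] by simp
  qed
qed

lemma comonotone_pos_cost_le:
  assumes meas [measurable]: "X \<in> borel_measurable M" "Y \<in> borel_measurable M"
      "X' \<in> borel_measurable M" "Y' \<in> borel_measurable M"
    and law: "distr M borel X' = distr M borel X" "distr M borel Y' = distr M borel Y"
    and A: "AE \<omega> in M. \<omega> \<in> A" "comonotone_on A X Y" and p: "p \<ge> 1"
  shows "(\<integral>\<^sup>+\<omega>. ennreal (max 0 (X \<omega> - Y \<omega>) powr p) \<partial>M)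
       \<le> (\<integral>\<^sup>+\<omega>. ennreal (max 0 (X' \<omega> - Y' \<omega>) powr p) \<partial>M)"
proof -
  interpret P: pair_sigma_finite M "lborel :: (real \<times> real) measure"
    by (intro pair_sigma_finite.intro sigma_finite_measure_axioms sigma_finite_lborel)
  have eq: "(\<integral>\<^sup>+\<omega>. ennreal (max 0 (f \<omega> - h \<omega>) powr p) \<partial>M)
      = (\<integral>\<^sup>+z. ennreal (prob {\<omega>\<in>space M. layer p (f \<omega>) (h \<omega>) z}) \<partial>lborel)"
    if [measurable]: "f \<in> borel_measurable M" "h \<in> borel_measurable M" for f h
  proof -
    have "(\<integral>\<^sup>+\<omega>. ennreal (max 0 (f \<omega> - h \<omega>) powr p) \<partial>M)
        = (\<integral>\<^sup>+\<omega>. (\<integral>\<^sup>+z. (if layer p (f \<omega>) (h \<omega>) z then 1 else 0) \<partial>lborel) \<partial>M)"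
      by (simp add: nn_integral_layer[OF p])
    also have "\<dots> = (\<integral>\<^sup>+z. (\<integral>\<^sup>+\<omega>. (if layer p (f \<omega>) (h \<omega>) z then 1 else 0) \<partial>M) \<partial>lborel)"
      by (rule P.Fubini'[symmetric]) measurable
    also have "\<dots> = (\<integral>\<^sup>+z. ennreal (prob {\<omega>\<in>space M. layer p (f \<omega>) (h \<omega>) z}) \<partial>lborel)"
    proof (rule nn_integral_cong)
      fix z :: "real \<times> real"
      have "(\<integral>\<^sup>+\<omega>. (if layer p (f \<omega>) (h \<omega>) z then 1 else 0) \<partial>M)
          = (\<integral>\<^sup>+\<omega>. indicator {\<omega>\<in>space M. layer p (f \<omega>) (h \<omega>) z} \<omega> \<partial>M)"
        by (rule nn_integral_cong) (simp add: indicator_def)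
      then show "(\<integral>\<^sup>+\<omega>. (if layer p (f \<omega>) (h \<omega>) z then 1 else 0) \<partial>M)
          = ennreal (prob {\<omega>\<in>space M. layer p (f \<omega>) (h \<omega>) z})"
        by (simp add: emeasure_eq_measure)
    qed
    finally show ?thesis .
  qed
  have "prob {\<omega>\<in>space M. layer p (X \<omega>) (Y \<omega>) z} \<le> prob {\<omega>\<in>space M. layer p (X' \<omega>) (Y' \<omega>) z}"
    for z :: "real \<times> real"
  proof -
    \<comment> \<open>For fixed \<open>z\<close> the layer condition separates into X in an up-set
      and Y in a down-set; the second is closed downwards because p >= 1.\<close>
    let ?U = "{x. fst z \<le> x}"
    let ?D = "{y. y < fst z \<and> 0 \<le> snd z \<and> snd z < p * (fst z - y) powr (p - 1)}"
    have down: "y' \<in> ?D" if "y \<in> ?D" "y' \<le> y" for y y'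
    proof -
      have "(fst z - y) powr (p - 1) \<le> (fst z - y') powr (p - 1)"
        using that p by (intro powr_mono2) auto
      then have "p * (fst z - y) powr (p - 1) \<le> p * (fst z - y') powr (p - 1)"
        using p by (intro mult_left_mono) auto
      with that show ?thesis by auto
    qed
    have "prob {\<omega>\<in>space M. X \<omega> \<in> ?U \<and> Y \<omega> \<in> ?D} \<le> prob {\<omega>\<in>space M. X' \<omega> \<in> ?U \<and> Y' \<omega> \<in> ?D}"
    proof (rule comonotone_prob_le[OF meas law A])
      show "?D \<in> sets borel" "?U \<in> sets borel"
        by measurable
    qed (use down in auto)
    then show ?thesis
      by (simp add: layer_def)
  qed
  then show ?thesis
    unfolding eq[OF meas(1,2)] eq[OF meas(3,4)] by (intro nn_integral_mono ennreal_leI)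
qed

text \<open>|x - y|^p is the sum of the p-th powers of the positive parts of x - y and y - x. The
  second term is the first with the roles exchanged, and comonotonicity is symmetric.\<close>

lemma comonotone_cost_le:
  assumes meas [measurable]: "X \<in> borel_measurable M" "Y \<in> borel_measurable M"
      "X' \<in> borel_measurable M" "Y' \<in> borel_measurable M"
    and law: "distr M borel X' = distr M borel X" "distr M borel Y' = distr M borel Y"
    and A: "AE \<omega> in M. \<omega> \<in> A" "comonotone_on A X Y" and p: "p \<ge> 1"
  shows "(\<integral>\<^sup>+\<omega>. ennreal (\<bar>X \<omega> - Y \<omega>\<bar> powr p) \<partial>M) \<le> (\<integral>\<^sup>+\<omega>. ennreal (\<bar>X' \<omega> - Y' \<omega>\<bar> powr p) \<partial>M)"
proof -
  have split: "(\<integral>\<^sup>+\<omega>. ennreal (\<bar>f \<omega> - h \<omega>\<bar> powr p) \<partial>M)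
      = (\<integral>\<^sup>+\<omega>. ennreal (max 0 (f \<omega> - h \<omega>) powr p) \<partial>M)
        + (\<integral>\<^sup>+\<omega>. ennreal (max 0 (h \<omega> - f \<omega>) powr p) \<partial>M)"
    if [measurable]: "f \<in> borel_measurable M" "h \<in> borel_measurable M" for f h :: "'a \<Rightarrow> real"
  proof -
    have "ennreal (\<bar>f \<omega> - h \<omega>\<bar> powr p)
        = ennreal (max 0 (f \<omega> - h \<omega>) powr p) + ennreal (max 0 (h \<omega> - f \<omega>) powr p)" for \<omega>
      by (auto simp: max_def)
    then show ?thesis
      by (simp add: nn_integral_add)
  qed
  show ?thesis
    unfolding split[OF meas(1,2)] split[OF meas(3,4)]
    by (intro add_mono comonotone_pos_cost_le[OF meas law A p]
        comonotone_pos_cost_le[OF meas(2,1,4,3) law(2,1) A(1) comonotone_on_commute[OF A(2)] p])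
qed

end

section \<open>Realizing laws on a non-atomic space\<close>

text \<open>With digits 0 and 1 in base 3, everything after the first differing digit j amounts to
  at most (1/3)^j / 2 and cannot cancel the difference (1/3)^j. In base 2 it could.\<close>

lemma ternary_series_inj:
  fixes s t :: "nat \<Rightarrow> bool"
  assumes "(\<Sum>i. (1/3) ^ i * of_bool (s i) :: real) = (\<Sum>i. (1/3) ^ i * of_bool (t i))"
  shows "s = t"
proof (rule ccontr)
  assume "s \<noteq> t"
  then have ex: "\<exists>i. s i \<noteq> t i"
    by auto
  define j where "j = (LEAST i. s i \<noteq> t i)"
  have j: "s j \<noteq> t j" and below: "\<And>i. i < j \<Longrightarrow> s i = t i"
    using LeastI_ex[OF ex] not_less_Least unfolding j_def by auto
  have geom: "summable (\<lambda>i. (1/3::real) ^ i)"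
    by (simp add: summable_geometric)
  have summ: "summable (\<lambda>i. (1/3) ^ i * of_bool (r i) :: real)" for r :: "nat \<Rightarrow> bool"
    by (rule summable_comparison_test'[OF geom]) auto
  define d where "d = (\<lambda>i. (1/3) ^ i * (of_bool (s i) - of_bool (t i)) :: real)"
  have abs_d: "\<bar>d i\<bar> \<le> (1/3) ^ i" for i
    by (simp add: d_def abs_mult)
  have d: "summable d" "suminf d = 0"
    using summable_diff[OF summ summ, of s t] suminf_diff[OF summ summ, of s t] assms
    by (simp_all add: d_def right_diff_distrib)
  let ?tail = "\<Sum>i. d (i + Suc j)"
  have "(\<Sum>i<Suc j. d i) = d j"
    using below by (simp add: d_def)
  then have "?tail = - d j"
    using suminf_split_initial_segment[OF d(1), of "Suc j"] d(2) by simp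
  moreover have "\<bar>d j\<bar> = (1/3) ^ j"
    using j by (auto simp: d_def abs_mult)
  moreover have "\<bar>?tail\<bar> \<le> (\<Sum>i. (1/3) ^ Suc j * (1/3) ^ i)"
  proof -
    have sg: "summable (\<lambda>i. (1/3) ^ Suc j * (1/3 :: real) ^ i)"
      using geom by (rule summable_mult)
    have le: "\<bar>d (i + Suc j)\<bar> \<le> (1/3) ^ Suc j * (1/3) ^ i" for i
      using abs_d[of "i + Suc j"] by (simp add: power_add ac_simps)
    have sd: "summable (\<lambda>i. \<bar>d (i + Suc j)\<bar>)"
      by (rule summable_comparison_test'[OF sg]) (use le in auto)
    have "\<bar>?tail\<bar> \<le> (\<Sum>i. \<bar>d (i + Suc j)\<bar>)"
      by (rule summable_rabs[OF sd])
    also have "\<dots> \<le> (\<Sum>i. (1/3) ^ Suc j * (1/3) ^ i)"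
      using le by (rule suminf_le[OF _ sd sg])
    finally show ?thesis .
  qed
  moreover have "(\<Sum>i. (1/3) ^ Suc j * (1/3 :: real) ^ i) = (1/3) ^ j / 2"
    using suminf_mult[OF geom, of "(1/3) ^ Suc j"] by (simp add: suminf_geometric)
  moreover have "(1/3 :: real) ^ j > 0"
    by simp
  ultimately show False
    by linarith
qed

text \<open>A point is encoded by its memberships in a countable family of Borel sets that separates
  points; these serve as ternary digits.\<close>

lemma Rborel_injection:
  obtains T :: "(nat \<Rightarrow> real) \<Rightarrow> real"
  where "T \<in> borel_measurable (Rborel n)" "inj_on T (Rvec n)" "\<And>x. 0 \<le> T x" "\<And>x. T x \<le> 1"
proof -
  obtain B where B: "countable B" "\<And>b. b \<in> B \<Longrightarrow> openin (Rtop n) b \<and> b \<in> sets (Rborel n)"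
    "\<And>U x. openin (Rtop n) U \<Longrightarrow> x \<in> U \<Longrightarrow> \<exists>b\<in>B. x \<in> b \<and> b \<subseteq> U"
    using countable_box_basis by blast
  \<comment> \<open>A point of the space, present even for n = 0, shows that the basis is nonempty,
    so \<open>from_nat_into\<close> enumerates exactly its members.\<close>
  have "(\<lambda>i\<in>{..<n}. 0) \<in> Rvec n"
    by (simp add: Rvec_def)
  then have "B \<noteq> {}"
    using B(3)[OF openin_topspace] by (auto simp: topspace_Rtop)
  then have range: "range (from_nat_into B) = B"
    using B(1) by (simp add: range_from_nat_into)
  define e where "e = from_nat_into B"
  \<comment> \<open>The factor 2/3 normalises the geometric sum 3/2 to 1.\<close>
  define T where "T = (\<lambda>x. (2/3) * (\<Sum>i. (1/3) ^ i * of_bool (x \<in> e i)) :: real)"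
  have geom: "summable (\<lambda>i. (1/3::real) ^ i)"
    by (simp add: summable_geometric)
  have summ: "summable (\<lambda>i. (1/3) ^ i * of_bool (r i) :: real)" for r :: "nat \<Rightarrow> bool"
    by (rule summable_comparison_test'[OF geom]) auto
  have [measurable]: "e i \<in> sets (Rborel n)" for i
    using range B(2) by (auto simp: e_def)
  show ?thesis
  proof (rule that[of T])
    show "T \<in> borel_measurable (Rborel n)"
      unfolding T_def of_bool_def by measurable
    show "inj_on T (Rvec n)"
    proof (rule inj_onI, rule ccontr)
      fix x y assume xy: "x \<in> Rvec n" "y \<in> Rvec n" "T x = T y" "x \<noteq> y"
      then have "(\<lambda>i. x \<in> e i) = (\<lambda>i. y \<in> e i)"
        by (intro ternary_series_inj) (simp add: T_def)
      then have "x \<in> e i \<longleftrightarrow> y \<in> e i" for i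
        by (rule fun_cong)
      then have same: "x \<in> b \<longleftrightarrow> y \<in> b" if "b \<in> B" for b
        using range that unfolding e_def by (metis imageE)
      have "\<exists>i<n. x i \<noteq> y i"
      proof (rule ccontr)
        assume "\<not> (\<exists>i<n. x i \<noteq> y i)"
        then have "x i = y i" if "i \<in> {..<n}" for i
          using that by auto
        then have "x = y"
          using xy(1,2) unfolding Rvec_def by (intro PiE_ext) auto
        with xy(4) show False ..
      qed
      then obtain i where i: "i < n" "x i \<noteq> y i"
        by blast
      let ?U = "open_cube n x \<bar>x i - y i\<bar>"
      have "x \<in> ?U" "y \<notin> ?U"
        using xy i by (auto simp: open_cube_def abs_minus_commute)
      then show False
        using B(3)[OF openin_open_cube \<open>x \<in> ?U\<close>] same by blast
    qed
    show "0 \<le> T x" for x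
      unfolding T_def by (intro mult_nonneg_nonneg suminf_nonneg summ) auto
    show "T x \<le> 1" for x
    proof -
      have "(\<Sum>i. (1/3) ^ i * of_bool (x \<in> e i) :: real) \<le> (\<Sum>i. (1/3) ^ i)"
        by (intro suminf_le summ geom) auto
      then show ?thesis
        by (simp add: T_def suminf_geometric)
    qed
  qed
qed

lemma (in prob_space) nonatomic_singleton:
  assumes "nonatomic M" "{x} \<in> events"
  shows "prob {x} = 0"
proof (rule ccontr)
  assume "prob {x} \<noteq> 0"
  then have "0 < prob {x}"
    by (simp add: less_le)
  then obtain B where "B \<in> events" "B \<subseteq> {x}" "0 < prob B" "prob B < prob {x}"
    using assms unfolding nonatomic_def by blast
  then show False
    by (auto dest: subset_singletonD)
qed

text \<open>The passage from non-atomicity to a real random variable: level sets of an injective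
  Borel map are empty or singletons, and a singleton of positive mass would be an atom.\<close>

lemma atomless_variable:
  assumes "prob_space M" and sets: "sets M = sets (Rborel n)" and na: "nonatomic M"
  obtains T :: "(nat \<Rightarrow> real) \<Rightarrow> real" where "T \<in> borel_measurable M" "\<And>\<omega>. 0 \<le> T \<omega>" "\<And>\<omega>. T \<omega> \<le> 1"
    "\<And>t. measure M {\<omega>\<in>space M. T \<omega> = t} = 0"
proof -
  interpret prob_space M by fact
  obtain T :: "(nat \<Rightarrow> real) \<Rightarrow> real" where T: "T \<in> borel_measurable (Rborel n)" "inj_on T (Rvec n)"
    "\<And>x. 0 \<le> T x" "\<And>x. T x \<le> 1"
    using Rborel_injection by blast
  have space: "space M = Rvec n"
    using sets_eq_imp_space_eq[OF sets] by (simp add: space_Rborel)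
  have "measure M {\<omega>\<in>space M. T \<omega> = t} = 0" for t
  proof (cases "\<exists>x\<in>space M. T x = t")
    case True
    then obtain x where x: "x \<in> Rvec n" "T x = t"
      using space by blast
    then have eq: "{\<omega>\<in>space M. T \<omega> = t} = {x}"
      using T(2) space by (auto dest: inj_onD)
    have "{x} = PiE {..<n} (\<lambda>i. {x i})"
      using x(1) by (simp add: Rvec_def PiE_iff PiE_singleton)
    also have "\<dots> \<in> sets (Rborel n)"
      unfolding Rborel_def by (rule sets_PiM_I_finite) auto
    finally show ?thesis
      unfolding eq using na sets by (intro nonatomic_singleton) auto
  next
    case False
    then have "{\<omega>\<in>space M. T \<omega> = t} = {}"
      by blast
    then show ?thesis
      by (simp only: measure_empty)
  qed
  moreover have "T \<in> borel_measurable M"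
    using T(1) by (simp add: measurable_cong_sets[OF sets refl])
  ultimately show ?thesis
    using that T(3,4) by blast
qed

section \<open>Splitting atoms; uniform and quantile transforms\<close>

context prob_space
begin

text \<open>
  The atoms of \<open>V\<close> are spread out by means of the atomless variable \<open>T\<close>: each value \<open>v\<close> is replaced
  by the interval between \<open>v + P(V < v)\<close> and \<open>v + P(V \<le> v)\<close>.
\<close>

lemma atomless_refinement:
  fixes T V :: "'a \<Rightarrow> real"
  assumes T [measurable]: "T \<in> borel_measurable M" and T01: "\<And>\<omega>. 0 \<le> T \<omega>" "\<And>\<omega>. T \<omega> \<le> 1"
    and T0: "\<And>t. prob {\<omega>\<in>space M. T \<omega> = t} = 0"
    and V [measurable]: "V \<in> borel_measurable M"
  obtains W :: "'a \<Rightarrow> real" where "W \<in> borel_measurable M" "\<And>w. prob {\<omega>\<in>space M. W \<omega> = w} = 0"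
    "\<And>\<omega> \<omega>'. V \<omega> < V \<omega>' \<Longrightarrow> W \<omega> < W \<omega>'"
proof -
  define G where "G = (\<lambda>v. prob {\<omega>\<in>space M. V \<omega> < v})"
  define F where "F = (\<lambda>v. prob {\<omega>\<in>space M. V \<omega> \<le> v})"
  have "mono G" "mono F"
    unfolding G_def F_def by (auto intro!: monoI finite_measure_mono)
  then have [measurable]: "G \<in> borel_measurable borel" "F \<in> borel_measurable borel"
    by (auto intro: borel_measurable_mono)
  have GF: "G v \<le> F v" "F v - G v = prob {\<omega>\<in>space M. V \<omega> = v}" for v
  proof -
    have "prob {\<omega>\<in>space M. V \<omega> \<le> v} - prob {\<omega>\<in>space M. V \<omega> < v}
        = prob ({\<omega>\<in>space M. V \<omega> \<le> v} - {\<omega>\<in>space M. V \<omega> < v})"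
      by (rule finite_measure_Diff[symmetric]) auto
    also have "{\<omega>\<in>space M. V \<omega> \<le> v} - {\<omega>\<in>space M. V \<omega> < v} = {\<omega>\<in>space M. V \<omega> = v}"
      by auto
    finally show "F v - G v = prob {\<omega>\<in>space M. V \<omega> = v}"
      by (simp add: F_def G_def)
    then show "G v \<le> F v"
      by (metis diff_ge_0_iff_ge measure_nonneg)
  qed
  have FG: "F v \<le> G v'" if "v < v'" for v v'
    unfolding F_def G_def using that by (intro finite_measure_mono) auto
  \<comment> \<open>The summand \<open>V\<close> makes W strictly increasing also between values v <
    v' of V with no mass between them, where \<open>F v = G v'\<close>.\<close>
  define W where "W = (\<lambda>\<omega>. V \<omega> + G (V \<omega>) + T \<omega> * (F (V \<omega>) - G (V \<omega>)))"
  have mono: "W \<omega> < W \<omega>'" if "V \<omega> < V \<omega>'" for \<omega> \<omega>'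
  proof -
    have "T \<omega> * (F (V \<omega>) - G (V \<omega>)) \<le> 1 * (F (V \<omega>) - G (V \<omega>))"
      using T01 GF(1) by (intro mult_right_mono) auto
    moreover have "0 \<le> T \<omega>' * (F (V \<omega>') - G (V \<omega>'))"
      using T01 GF(1) by auto
    ultimately show ?thesis
      using that FG[OF that] by (simp add: W_def)
  qed
  have "prob {\<omega>\<in>space M. W \<omega> = w} = 0" for w
  proof (cases "{\<omega>\<in>space M. W \<omega> = w} = {}")
    case False
    then obtain \<omega>0 where \<omega>0: "\<omega>0 \<in> space M" "W \<omega>0 = w"
      by blast
    let ?v = "V \<omega>0"
    have V_eq: "V \<omega> = ?v" if "W \<omega> = w" for \<omega>
      using mono[of \<omega> \<omega>0] mono[of \<omega>0 \<omega>] that \<omega>0(2) by (cases "V \<omega>" ?v rule: linorder_cases) auto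
    \<comment> \<open>The level set of W lies in one level set of V. Either that one is null, or on
      this atom W is affine in T with nonzero slope and the level set lies in a null level set of
      T.\<close>
    have "\<exists>S\<in>events. {\<omega>\<in>space M. W \<omega> = w} \<subseteq> S \<and> prob S = 0"
    proof (cases "F ?v = G ?v")
      case True
      then show ?thesis
        using V_eq GF(2)[of ?v] by (intro bexI[of _ "{\<omega>\<in>space M. V \<omega> = ?v}"]) auto
    next
      case False
      then have "T \<omega> = (w - ?v - G ?v) / (F ?v - G ?v)" if "W \<omega> = w" for \<omega>
        using V_eq[OF that] that by (simp add: W_def field_simps)
      then show ?thesis
        using T0 by (intro bexI[of _ "{\<omega>\<in>space M. T \<omega> = (w - ?v - G ?v) / (F ?v - G ?v)}"]) auto
    qed
    then show ?thesis
      by (metis (no_types, lifting) finite_measure_mono measure_nonneg order_antisym)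
  qed (simp only: measure_empty)
  moreover have "W \<in> borel_measurable M"
    unfolding W_def by measurable
  ultimately show ?thesis
    using that mono by blast
qed

lemma rcdf_eq_prob:
  "W \<in> borel_measurable M \<Longrightarrow> rcdf M W w = prob {\<omega>\<in>space M. W \<omega> \<le> w}"
  by (simp add: cdf_def measure_distr vimage_def Int_def conj_commute)

lemma probability_integral_transform:
  assumes W [measurable]: "W \<in> borel_measurable M" and W0: "\<And>w. prob {\<omega>\<in>space M. W \<omega> = w} = 0"
    and u: "0 \<le> u" "u \<le> 1"
  shows "prob {\<omega>\<in>space M. rcdf M W (W \<omega>) \<le> u} = u"
proof -
  let ?F = "rcdf M W"
  interpret D: real_distribution "distr M borel W"
    by simp
  have [measurable]: "?F \<in> borel_measurable borel"
    using D.cdf_nondecreasing by (intro borel_measurable_mono monoI)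
  have "measure (distr M borel W) {w} = 0" for w
    using W0[of w] by (simp add: measure_distr vimage_def Int_def conj_commute)
  then have cont: "isCont ?F w" for w
    by (simp add: D.isCont_cdf)
  have surj: "\<exists>w. ?F w = v" if v: "0 < v" "v < 1" for v
  proof -
    obtain x where x: "?F x < v"
      by (metis eventually_happens' trivial_limit_at_bot_linorder order_tendstoD(2) D.cdf_lim_at_bot v(1))
    obtain y where y: "v < ?F y"
      by (metis eventually_happens' trivial_limit_at_top_linorder order_tendstoD(1) D.cdf_lim_at_top_prob v(2))
    have "x \<le> y"
      using D.cdf_nondecreasing[of y x] x y by linarith
    then have "\<exists>w. x \<le> w \<and> w \<le> y \<and> ?F w = v"
      using x y cont by (intro IVT) auto
    then show ?thesis by blast
  qed
  \<comment> \<open>The cdf may be constant at the level u, so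
    \<open>?F (W \<omega>) \<le> u\<close> need not bound W by a chosen point of that level. A point
    of a slightly higher level v does bound it; then v decreases to u.\<close>
  have upper: "prob {\<omega>\<in>space M. ?F (W \<omega>) \<le> u} \<le> v" if v: "u < v" "v < 1" for v
  proof -
    obtain w where w: "?F w = v"
      using surj u v by force
    have "prob {\<omega>\<in>space M. ?F (W \<omega>) \<le> u} \<le> prob {\<omega>\<in>space M. W \<omega> \<le> w}"
    proof (rule finite_measure_mono)
      have "W \<omega> \<le> w" if "?F (W \<omega>) \<le> u" for \<omega>
        using D.cdf_nondecreasing[of w "W \<omega>"] that w v(1) by linarith
      then show "{\<omega>\<in>space M. ?F (W \<omega>) \<le> u} \<subseteq> {\<omega>\<in>space M. W \<omega> \<le> w}"
        by auto
    qed measurable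
    also have "\<dots> = v"
      using w by (simp add: rcdf_eq_prob)
    finally show ?thesis .
  qed
  have "prob {\<omega>\<in>space M. ?F (W \<omega>) \<le> u} \<le> u"
  proof (cases "u = 1")
    case False
    with u upper show ?thesis
      by (intro dense_le_bounded[where ?y = u] dense_ge_bounded[of u 1]) auto
  qed simp
  moreover have "u \<le> prob {\<omega>\<in>space M. ?F (W \<omega>) \<le> u}"
  proof -
    \<comment> \<open>A cdf need not attain the values 0 and 1, so the end points are treated
      directly.\<close>
    consider "u = 0" | "u = 1" | "0 < u" "u < 1"
      using u by linarith
    then show ?thesis
    proof cases
      case 2
      then have "{\<omega>\<in>space M. ?F (W \<omega>) \<le> u} = space M"
        using D.cdf_bounded_prob by auto
      then show ?thesis
        using prob_space u by simp
    next
      case 3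
      then obtain w where w: "?F w = u"
        using surj by blast
      have "u = prob {\<omega>\<in>space M. W \<omega> \<le> w}"
        using w by (simp add: rcdf_eq_prob)
      also have "\<dots> \<le> prob {\<omega>\<in>space M. ?F (W \<omega>) \<le> u}"
        using w D.cdf_nondecreasing by (intro finite_measure_mono) auto
      finally show ?thesis .
    qed simp
  qed
  ultimately show ?thesis by simp
qed

lemma comonotone_coupling:
  fixes T V Z :: "'a \<Rightarrow> real"
  assumes T: "T \<in> borel_measurable M" "\<And>\<omega>. 0 \<le> T \<omega>" "\<And>\<omega>. T \<omega> \<le> 1"
      "\<And>t. prob {\<omega>\<in>space M. T \<omega> = t} = 0"
    and V [measurable]: "V \<in> borel_measurable M" and Z: "Z \<in> borel_measurable M"
  obtains Z' A where "Z' \<in> borel_measurable M" "distr M borel Z' = distr M borel Z"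
    "AE \<omega> in M. \<omega> \<in> A" "comonotone_on A V Z'"
proof -
  obtain W :: "'a \<Rightarrow> real" where W [measurable]: "W \<in> borel_measurable M"
    and W0: "\<And>w. prob {\<omega>\<in>space M. W \<omega> = w} = 0" and VW: "\<And>\<omega> \<omega>'. V \<omega> < V \<omega>' \<Longrightarrow> W \<omega> < W \<omega>'"
    using atomless_refinement[OF T V] by blast
  let ?F = "rcdf M W"
  interpret D: real_distribution "distr M borel W"
    by simp
  interpret Q: cdf_distribution "distr M borel Z"
    using Z by (simp add: cdf_distribution_def)
  have [measurable]: "?F \<in> borel_measurable borel"
    using D.cdf_nondecreasing by (intro borel_measurable_mono monoI)
  define U where "U = (\<lambda>\<omega>. ?F (W \<omega>))"
  have [measurable]: "U \<in> borel_measurable M"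
    unfolding U_def by measurable
  have unif: "prob {\<omega>\<in>space M. U \<omega> \<le> u} = u" if "0 \<le> u" "u \<le> 1" for u
    using probability_integral_transform[OF W W0 that] by (simp add: U_def)
  have "prob {\<omega>\<in>space M. U \<omega> \<le> 0} = 0"
    by (rule unif) auto
  then have pos: "AE \<omega> in M. 0 < U \<omega>"
    by (subst (asm) prob_eq_0) (auto simp: not_le)
  \<comment> \<open>The uniform law is known through the events \<open>U \<omega> \<le> u\<close>;
    letting u increase to 1 gives the strict event full measure.\<close>
  have "prob {\<omega>\<in>space M. U \<omega> < 1} \<ge> u" if "0 \<le> u" "u < 1" for u
  proof -
    have "u = prob {\<omega>\<in>space M. U \<omega> \<le> u}"
      using unif[of u] that by simp
    also have "\<dots> \<le> prob {\<omega>\<in>space M. U \<omega> < 1}"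
      using that by (intro finite_measure_mono) auto
    finally show ?thesis .
  qed
  then have "prob {\<omega>\<in>space M. U \<omega> < 1} \<ge> 1"
    by (intro dense_le_bounded[of 0 1]) auto
  then have "prob {\<omega>\<in>space M. U \<omega> < 1} = 1"
    by (intro antisym) auto
  then have less1: "AE \<omega> in M. U \<omega> < 1"
    by (subst (asm) prob_eq_1) auto
  define A where "A = {\<omega>. 0 < U \<omega> \<and> U \<omega> < 1}"
  \<comment> \<open>The quantile function is used on the open unit interval only; the value 1/2
    fills in a null set.\<close>
  define U' where "U' = (\<lambda>\<omega>. if 0 < U \<omega> \<and> U \<omega> < 1 then U \<omega> else 1/2)"
  have U'01: "0 < U' \<omega>" "U' \<omega> < 1" for \<omega>
    by (auto simp: U'_def)
  have "U' \<in> borel_measurable M"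
    unfolding U'_def by measurable
  then have U': "U' \<in> measurable M (restrict_space borel {0<..<1})"
    using U'01 by (intro measurable_restrict_space2) auto
  define Z' where "Z' = (\<lambda>\<omega>. Q.I (U' \<omega>))"
  have Z': "Z' \<in> borel_measurable M"
    unfolding Z'_def by (rule measurable_compose[OF U' Q.measurable_CI])
  have A: "AE \<omega> in M. \<omega> \<in> A"
    using pos less1 by eventually_elim (simp add: A_def)
  have "rcdf M Z' z = rcdf M Z z" for z
  proof -
    \<comment> \<open>Quantile function and cdf form a Galois connection, which reduces the law of
      \<open>Z'\<close> to the uniform law of U.\<close>
    have "Z' \<omega> \<le> z \<longleftrightarrow> U' \<omega> \<le> rcdf M Z z" for \<omega>
      unfolding Z'_def by (rule Q.pseudoinverse[OF U'01, symmetric])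
    then have "rcdf M Z' z = prob {\<omega>\<in>space M. U' \<omega> \<le> rcdf M Z z}"
      by (simp only: rcdf_eq_prob[OF Z'])
    also have "\<dots> = prob {\<omega>\<in>space M. U \<omega> \<le> rcdf M Z z}"
    proof (rule finite_measure_eq_AE)
      have "\<omega> \<in> {\<omega>\<in>space M. U' \<omega> \<le> rcdf M Z z} \<longleftrightarrow> \<omega> \<in> {\<omega>\<in>space M. U \<omega> \<le> rcdf M Z z}"
        if "\<omega> \<in> A" for \<omega>
        using that by (simp add: A_def U'_def)
      then show "AE \<omega> in M. \<omega> \<in> {\<omega>\<in>space M. U' \<omega> \<le> rcdf M Z z}
          \<longleftrightarrow> \<omega> \<in> {\<omega>\<in>space M. U \<omega> \<le> rcdf M Z z}"
        by (rule eventually_mono[OF A])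
      show "{\<omega>\<in>space M. U' \<omega> \<le> rcdf M Z z} \<in> events"
        using \<open>U' \<in> borel_measurable M\<close> by measurable
    qed measurable
    also have "\<dots> = rcdf M Z z"
      using Q.cdf_nonneg Q.cdf_bounded_prob by (intro unif) auto
    finally show ?thesis .
  qed
  then have "rcdf M Z' = rcdf M Z"
    by blast
  then have law: "distr M borel Z' = distr M borel Z"
    using Z' Z by (rule rcdf_eq_imp_distr_eq[rotated 2])
  have "comonotone_on A V Z'"
    unfolding comonotone_on_def
  proof (intro ballI impI)
    fix \<omega> \<omega>' assume \<omega>: "\<omega> \<in> A" "\<omega>' \<in> A" "V \<omega> < V \<omega>'"
    have "U \<omega> \<le> U \<omega>'"
      unfolding U_def using VW[OF \<omega>(3)] D.cdf_nondecreasing by simp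
    then have "U' \<omega> \<le> U' \<omega>'"
      using \<omega> by (simp add: A_def U'_def)
    then show "Z' \<omega> \<le> Z' \<omega>'"
      unfolding Z'_def using U'01 by (intro mono_onD[OF Q.mono_I]) auto
  qed
  with Z' law A show ?thesis
    using that by blast
qed

end

section \<open>Wasserstein balls and their images\<close>

text \<open>Costs are compared as nonnegative integrals, while the Wasserstein distance is defined
  by \<open>LINT\<close>, which is 0 for a function that is not integrable. Membership in
  \<open>Lp_real\<close> makes the two agree.\<close>

lemma Lp_real_integral_diff:
  assumes "X \<in> Lp_real M p" "Y \<in> Lp_real M p" "p \<ge> 0"
  shows "integrable M (\<lambda>\<omega>. \<bar>X \<omega> - Y \<omega>\<bar> powr p)"
    and "(\<integral>\<^sup>+\<omega>. ennreal (\<bar>X \<omega> - Y \<omega>\<bar> powr p) \<partial>M) = ennreal (LINT \<omega>|M. \<bar>X \<omega> - Y \<omega>\<bar> powr p)"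
proof -
  show *: "integrable M (\<lambda>\<omega>. \<bar>X \<omega> - Y \<omega>\<bar> powr p)"
    using Lp_real_diff[OF assms] by (simp add: Lp_real_def)
  show "(\<integral>\<^sup>+\<omega>. ennreal (\<bar>X \<omega> - Y \<omega>\<bar> powr p) \<partial>M) = ennreal (LINT \<omega>|M. \<bar>X \<omega> - Y \<omega>\<bar> powr p)"
    by (rule nn_integral_eq_integral[OF *]) simp
qed

lemma wasserstein_real_le:
  assumes "X \<in> borel_measurable M" "Y \<in> borel_measurable M" "rcdf M X = F" "rcdf M Y = G"
  shows "wasserstein_real M p F G \<le> (LINT \<omega>|M. \<bar>X \<omega> - Y \<omega>\<bar> powr p) powr (1 / p)"
  unfolding wasserstein_real_def by (rule cInf_lower) (use assms in \<open>auto intro!: bdd_belowI[of _ 0]\<close>)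

lemma wasserstein_vec_le:
  assumes "X \<in> measurable M (Rborel k)" "Y \<in> measurable M (Rborel k)"
  shows "wasserstein_vec M p a k (vcdf M k X) (vcdf M k Y)
       \<le> (LINT \<omega>|M. vdist a k (X \<omega>) (Y \<omega>) powr p) powr (1 / p)"
  unfolding wasserstein_vec_def by (rule cInf_lower) (use assms in \<open>auto intro!: bdd_belowI[of _ 0]\<close>)

lemma block1_measurable:
  "m \<le> n \<Longrightarrow> block1 m \<in> measurable (Rborel n) (Rborel m)"
  unfolding block1_def Rborel_def by (rule measurable_restrict_subset) auto

lemma block_function_measurable:
  assumes "m \<le> n" "f \<in> borel_measurable (Rborel m)"
    and g: "\<forall>x\<in>Rvec n. g x = f (block1 m x) + (\<Sum>i<n - m. \<beta> i * block2 m n x i)"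
  shows "g \<in> borel_measurable (Rborel n)"
proof -
  have "(\<lambda>x. f (block1 m x)) \<in> borel_measurable (Rborel n)"
    using block1_measurable[OF assms(1)] assms(2) by (rule measurable_compose)
  moreover have "(\<lambda>x. \<Sum>i<n - m. \<beta> i * block2 m n x i) \<in> borel_measurable (Rborel n)"
  proof (rule borel_measurable_sum)
    fix i assume i: "i \<in> {..<n - m}"
    then have "(\<lambda>x. x (m + i)) \<in> borel_measurable (Rborel n)"
      by (intro measurable_Rborel_component) auto
    with i show "(\<lambda>x. \<beta> i * block2 m n x i) \<in> borel_measurable (Rborel n)"
      by (simp add: block2_def)
  qed
  ultimately have "(\<lambda>x. f (block1 m x) + (\<Sum>i<n - m. \<beta> i * block2 m n x i)) \<in> borel_measurable (Rborel n)"
    by (rule borel_measurable_add)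
  then show ?thesis
    using g by (subst measurable_cong) (auto simp: space_Rborel)
qed

section \<open>The two inclusions\<close>

context prob_space
begin

text \<open>Every competing pair has the same marginal laws, so it is p-integrable and costs at
  least as much as the comonotone pair. That pair contains the given \<open>V\<close>, as the later
  shift of \<open>X\<close> requires.\<close>

lemma optimal_coupling:
  fixes T V Z :: "'a \<Rightarrow> real"
  assumes T: "T \<in> borel_measurable M" "\<And>\<omega>. 0 \<le> T \<omega>" "\<And>\<omega>. T \<omega> \<le> 1"
      "\<And>t. prob {\<omega>\<in>space M. T \<omega> = t} = 0"
    and V: "V \<in> Lp_real M p" and Z: "Z \<in> Lp_real M p" and p: "p \<ge> 1"
  obtains Z' where "Z' \<in> Lp_real M p" "distr M borel Z' = distr M borel Z"
    "(LINT \<omega>|M. \<bar>Z' \<omega> - V \<omega>\<bar> powr p) powr (1 / p) \<le> wasserstein_real M p (rcdf M Z) (rcdf M V)"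
proof -
  have meas: "V \<in> borel_measurable M" "Z \<in> borel_measurable M"
    using V Z by (auto simp: Lp_real_def)
  obtain Z' A where Z': "Z' \<in> borel_measurable M" "distr M borel Z' = distr M borel Z"
    and A: "AE \<omega> in M. \<omega> \<in> A" "comonotone_on A V Z'"
    using comonotone_coupling[OF T meas] by blast
  have Z'L: "Z' \<in> Lp_real M p"
    using Lp_real_distr_cong[OF Z Z'] .
  have p0: "p \<ge> 0" using p by simp
  let ?c = "\<lambda>P Q. LINT \<omega>|M. \<bar>P \<omega> - Q \<omega>\<bar> powr p"
  have "?c Z' V powr (1 / p) \<le> wasserstein_real M p (rcdf M Z) (rcdf M V)"
    unfolding wasserstein_real_def
  proof (rule cInf_greatest)
    have "\<exists>P Q. P \<in> borel_measurable M \<and> Q \<in> borel_measurable M \<and>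
        rcdf M P = rcdf M Z \<and> rcdf M Q = rcdf M V"
      using meas by blast
    then show "{?c P Q powr (1 / p) | P Q. P \<in> borel_measurable M \<and> Q \<in> borel_measurable M \<and>
        rcdf M P = rcdf M Z \<and> rcdf M Q = rcdf M V} \<noteq> {}"
      by blast
    fix c assume "c \<in> {?c P Q powr (1 / p) | P Q. P \<in> borel_measurable M \<and> Q \<in> borel_measurable M \<and>
        rcdf M P = rcdf M Z \<and> rcdf M Q = rcdf M V}"
    then obtain P Q where PQ: "P \<in> borel_measurable M" "Q \<in> borel_measurable M"
      "rcdf M P = rcdf M Z" "rcdf M Q = rcdf M V" and c: "c = ?c P Q powr (1 / p)"
      by blast
    have law: "distr M borel P = distr M borel Z" "distr M borel Q = distr M borel V"
      using PQ meas by (auto intro: rcdf_eq_imp_distr_eq)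
    have PQL: "P \<in> Lp_real M p" "Q \<in> Lp_real M p"
      using Lp_real_distr_cong[OF Z PQ(1) law(1)] Lp_real_distr_cong[OF V PQ(2) law(2)] by auto
    have "ennreal (?c Z' V) \<le> ennreal (?c P Q)"
      unfolding Lp_real_integral_diff(2)[OF Z'L V p0, symmetric] Lp_real_integral_diff(2)[OF PQL p0, symmetric]
      by (rule comonotone_cost_le[OF Z'(1) meas(1) PQ(1,2) _ law(2) A(1) comonotone_on_commute[OF A(2)] p])
         (simp add: law(1) Z'(2))
    then have "?c Z' V \<le> ?c P Q"
      by (simp add: ennreal_le_iff)
    then show "?c Z' V powr (1 / p) \<le> c"
      unfolding c using p by (intro powr_mono2) auto
  qed
  with Z'L Z'(2) show ?thesis
    using that by blast
qed

lemma ball_real_subset_image: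
  fixes a p \<epsilon> :: real and b :: ereal and T :: "'a \<Rightarrow> real" and X :: "'a \<Rightarrow> nat \<Rightarrow> real"
  assumes p: "p \<ge> 1" and ab: "a \<ge> 1" "b \<ge> 1" "1 / ereal a + 1 / b = 1"
    and T: "T \<in> borel_measurable M" "\<And>\<omega>. 0 \<le> T \<omega>" "\<And>\<omega>. T \<omega> \<le> 1"
      "\<And>t. prob {\<omega>\<in>space M. T \<omega> = t} = 0"
    and mn: "m \<le> n"
    and g: "\<forall>x\<in>Rvec n. g x = g' (block1 m x) + (\<Sum>i<n - m. \<beta> i * block2 m n x i)"
    and X: "X \<in> Lp_vec M p a n" and gX: "(\<lambda>\<omega>. g (X \<omega>)) \<in> Lp_real M p"
    and supp: "support M m (\<lambda>\<omega>. block1 m (X \<omega>)) \<subseteq> C" and \<epsilon>: "\<epsilon> \<ge> 0"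
  shows "ball_real M p (vnorm b (n - m) \<beta> * \<epsilon>) (\<lambda>\<omega>. g (X \<omega>))
       \<subseteq> law_hull M (rv_image g (ball_vec M p a n m \<epsilon> C X))"
proof
  let ?B = "vnorm b (n - m) \<beta>"
  define V where "V = (\<lambda>\<omega>. g (X \<omega>))"
  fix Z assume "Z \<in> ball_real M p (?B * \<epsilon>) (\<lambda>\<omega>. g (X \<omega>))"
  then have Z: "Z \<in> Lp_real M p" "wasserstein_real M p (rcdf M Z) (rcdf M V) \<le> ?B * \<epsilon>"
    by (auto simp: ball_real_def V_def)
  have V: "V \<in> Lp_real M p"
    using gX by (simp add: V_def)
  obtain Z' where Z': "Z' \<in> Lp_real M p" "distr M borel Z' = distr M borel Z"
    and "(LINT \<omega>|M. \<bar>Z' \<omega> - V \<omega>\<bar> powr p) powr (1 / p) \<le> wasserstein_real M p (rcdf M Z) (rcdf M V)"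
    using optimal_coupling[OF T V Z(1) p] by blast
  then have cost: "(LINT \<omega>|M. \<bar>Z' \<omega> - V \<omega>\<bar> powr p) powr (1 / p) \<le> ?B * \<epsilon>"
    using Z(2) by linarith
  have p0: "p \<ge> 0" using p by simp
  have meas: "Z \<in> borel_measurable M" "Z' \<in> borel_measurable M" "V \<in> borel_measurable M"
    using Z Z' V by (auto simp: Lp_real_def)
  have Xm: "X \<in> measurable M (Rborel n)"
    using X by (simp add: Lp_vec_def)
  \<comment> \<open>The vector to be constructed reproduces \<open>Z'\<close>, at least in law;
    since \<open>Z'\<close> is only a copy of \<open>Z\<close>, this places \<open>Z\<close> in the
    hull of the image.\<close>
  have hullI: "Z \<in> law_hull M (rv_image g (ball_vec M p a n m \<epsilon> C X))"
    if Y: "Y \<in> ball_vec M p a n m \<epsilon> C X" and law: "distr M borel (\<lambda>\<omega>. g (Y \<omega>)) = distr M borel Z'" for Y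
  proof -
    have "(\<lambda>\<omega>. g (Y \<omega>)) \<in> rv_image g (ball_vec M p a n m \<epsilon> C X)"
      unfolding rv_image_def using Y by (rule imageI)
    moreover have "rcdf M Z = rcdf M (\<lambda>\<omega>. g (Y \<omega>))"
      by (simp only: law Z'(2))
    ultimately show ?thesis
      unfolding law_hull_def using meas(1) by blast
  qed
  show "Z \<in> law_hull M (rv_image g (ball_vec M p a n m \<epsilon> C X))"
  proof (cases "?B = 0")
    case True
    have int: "integrable M (\<lambda>\<omega>. \<bar>Z' \<omega> - V \<omega>\<bar> powr p)"
      by (rule Lp_real_integral_diff(1)[OF Z'(1) V p0])
    have "(LINT \<omega>|M. \<bar>Z' \<omega> - V \<omega>\<bar> powr p) powr (1 / p) \<le> 0"
      using cost True by simp
    then have "(LINT \<omega>|M. \<bar>Z' \<omega> - V \<omega>\<bar> powr p) = 0"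
      by (simp add: le_less)
    then have "AE \<omega> in M. \<bar>Z' \<omega> - V \<omega>\<bar> powr p = 0"
      using integral_nonneg_eq_0_iff_AE[OF int] by simp
    \<comment> \<open>\<open>Z' = V\<close> almost surely, so \<open>X\<close> itself has an image
      with the law of \<open>Z'\<close>.\<close>
    then have "AE \<omega> in M. V \<omega> = Z' \<omega>"
      by (rule eventually_mono) simp
    then have "distr M borel V = distr M borel Z'"
      using meas by (intro distr_cong_AE) auto
    moreover have "X \<in> ball_vec M p a n m \<epsilon> C X"
      using wasserstein_vec_le[OF Xm Xm, of p a] X supp \<epsilon> by (simp add: ball_vec_def vnorm_zero)
    ultimately show ?thesis
      by (intro hullI[of X]) (simp_all add: V_def)
  next
    case False
    then have B: "?B > 0"
      using vnorm_nonneg[of b "n - m" \<beta>] by linarith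
    obtain d where d: "(\<Sum>i<n - m. \<beta> i * d i) = ?B" "vnorm (ereal a) (n - m) d = 1"
      using dual_vector[OF ab False] by blast
    define c where "c = (\<lambda>\<omega>. (Z' \<omega> - V \<omega>) / ?B)"
    \<comment> \<open>Only the second block moves, so the support condition on the first is
      inherited from \<open>X\<close>. The factor \<open>c\<close> scales the dual vector so that
      the linear part changes by exactly \<open>Z' - V\<close>; the restriction keeps
      \<open>Y\<close> extensional.\<close>
    define Y where "Y = (\<lambda>\<omega>. \<lambda>i\<in>{..<n}. if i < m then X \<omega> i else X \<omega> i + d (i - m) * c \<omega>)"
    have Y1: "block1 m (Y \<omega>) = block1 m (X \<omega>)" for \<omega>
      using mn by (auto simp: block1_def Y_def fun_eq_iff)
    have Y2: "block2 m n (Y \<omega>) i = block2 m n (X \<omega>) i + d i * c \<omega>" if "i < n - m" for \<omega> i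
    proof -
      have "m + i < n"
        using that by simp
      then show ?thesis
        using that by (simp add: block2_def Y_def)
    qed
    have cL: "c \<in> Lp_real M p"
      using Lp_real_mult[OF Lp_real_diff[OF Z'(1) V p0], of "1 / ?B"] by (simp add: c_def)
    have XL: "(\<lambda>\<omega>. X \<omega> i) \<in> Lp_real M p" if "i < n" for i
      using X that by (simp add: Lp_vec_iff[OF ab(1) p0])
    have YL: "(\<lambda>\<omega>. Y \<omega> i) \<in> Lp_real M p" if i: "i < n" for i
    proof (cases "i < m")
      case True
      then show ?thesis
        using XL[OF i] i by (simp add: Y_def)
    next
      case False
      then show ?thesis
        using Lp_real_add[OF XL[OF i] Lp_real_mult[OF cL, of "d (i - m)"] p0] i by (simp add: Y_def)
    qed
    have Ym: "Y \<in> measurable M (Rborel n)"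
    proof (rule measurable_RborelI)
      show "Y \<omega> \<in> Rvec n" for \<omega>
        by (simp add: Y_def Rvec_def)
      show "(\<lambda>\<omega>. Y \<omega> i) \<in> borel_measurable M" if "i < n" for i
        using YL[OF that] by (simp add: Lp_real_def)
    qed
    have Y: "Y \<in> Lp_vec M p a n"
      using Ym YL by (simp add: Lp_vec_iff[OF ab(1) p0])
    have gY: "g (Y \<omega>) = Z' \<omega>" if "\<omega> \<in> space M" for \<omega>
    proof -
      have "X \<omega> \<in> Rvec n" "Y \<omega> \<in> Rvec n"
        using measurable_space[OF Xm that] measurable_space[OF Ym that] by (simp_all add: space_Rborel)
      then have "g (Y \<omega>) = g' (block1 m (X \<omega>)) + (\<Sum>i<n - m. \<beta> i * (block2 m n (X \<omega>) i + d i * c \<omega>))"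
        using g by (simp add: Y1 Y2)
      also have "(\<Sum>i<n - m. \<beta> i * (block2 m n (X \<omega>) i + d i * c \<omega>))
          = (\<Sum>i<n - m. \<beta> i * block2 m n (X \<omega>) i) + (\<Sum>i<n - m. \<beta> i * d i) * c \<omega>"
        by (simp add: distrib_left sum.distrib sum_distrib_right mult.assoc)
      finally show ?thesis
        using g \<open>X \<omega> \<in> Rvec n\<close> B by (simp add: d(1) c_def V_def)
    qed
    have dist: "vdist a n (Y \<omega>) (X \<omega>) = \<bar>Z' \<omega> - V \<omega>\<bar> / ?B" for \<omega>
    proof -
      have a0: "a \<noteq> 0" using ab(1) by simp
      have "(\<Sum>i<n. \<bar>Y \<omega> i - X \<omega> i\<bar> powr a)
          = (\<Sum>i<m. \<bar>Y \<omega> i - X \<omega> i\<bar> powr a) + (\<Sum>i<n - m. \<bar>Y \<omega> (m + i) - X \<omega> (m + i)\<bar> powr a)"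
        using mn by (rule sum_blocks)
      also have "(\<Sum>i<m. \<bar>Y \<omega> i - X \<omega> i\<bar> powr a) = 0"
        using mn by (intro sum.neutral) (auto simp: Y_def)
      also have "(\<Sum>i<n - m. \<bar>Y \<omega> (m + i) - X \<omega> (m + i)\<bar> powr a) = (\<Sum>i<n - m. \<bar>d i\<bar> powr a * \<bar>c \<omega>\<bar> powr a)"
      proof (intro sum.cong refl)
        fix i assume "i \<in> {..<n - m}"
        then have "m + i < n"
          by simp
        then show "\<bar>Y \<omega> (m + i) - X \<omega> (m + i)\<bar> powr a = \<bar>d i\<bar> powr a * \<bar>c \<omega>\<bar> powr a"
          by (simp add: Y_def abs_mult powr_mult)
      qed
      also have "\<dots> = \<bar>c \<omega>\<bar> powr a"
        using vnorm_powr[OF a0, of "n - m" d] d(2) by (simp add: sum_distrib_right[symmetric])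
      finally have "vdist a n (Y \<omega>) (X \<omega>) = \<bar>c \<omega>\<bar>"
        using a0 by (simp add: vnorm_real powr_powr)
      then show ?thesis
        using B by (simp add: c_def abs_divide)
    qed
    have "(LINT \<omega>|M. vdist a n (Y \<omega>) (X \<omega>) powr p) powr (1 / p)
        = ((LINT \<omega>|M. \<bar>Z' \<omega> - V \<omega>\<bar> powr p) / ?B powr p) powr (1 / p)"
      using B by (simp add: dist powr_divide)
    also have "\<dots> = (LINT \<omega>|M. \<bar>Z' \<omega> - V \<omega>\<bar> powr p) powr (1 / p) / ?B"
      using B p by (simp add: powr_divide powr_powr)
    also have "\<dots> \<le> \<epsilon>"
      using cost B by (simp add: divide_le_eq mult.commute)
    finally have "wasserstein_vec M p a n (vcdf M n Y) (vcdf M n X) \<le> \<epsilon>"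
      using wasserstein_vec_le[OF Ym Xm, of p a] by linarith
    then have "Y \<in> ball_vec M p a n m \<epsilon> C X"
      using Y supp by (simp add: ball_vec_def Y1)
    moreover have "distr M borel (\<lambda>\<omega>. g (Y \<omega>)) = distr M borel Z'"
      by (rule distr_cong) (simp_all add: gY)
    ultimately show ?thesis
      by (rule hullI)
  qed
qed

text \<open>Applying \<open>g\<close> to any coupling of the laws of Z and X gives a coupling of the
  image laws at no more than K times the cost; the infimum over all of them yields the
  radius.\<close>

lemma image_subset_ball_real:
  fixes a p \<epsilon> K :: real and X :: "'a \<Rightarrow> nat \<Rightarrow> real"
  assumes p: "p \<ge> 1" and a: "a \<ge> 1" and mn: "m \<le> n"
    and K: "lipschitz_bound a n {x\<in>Rvec n. block1 m x \<in> C} g K"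
    and gm: "g \<in> borel_measurable (Rborel n)" and C: "C \<in> sets (Rborel m)"
    and X: "X \<in> Lp_vec M p a n" and gX: "(\<lambda>\<omega>. g (X \<omega>)) \<in> Lp_real M p"
    and supp: "support M m (\<lambda>\<omega>. block1 m (X \<omega>)) \<subseteq> C"
  shows "rv_image g (ball_vec M p a n m \<epsilon> C X) \<subseteq> ball_real M p (K * \<epsilon>) (\<lambda>\<omega>. g (X \<omega>))"
proof -
  let ?S = "{x\<in>Rvec n. block1 m x \<in> C}"
  have p0: "p \<ge> 0" using p by simp
  have K0: "K \<ge> 0"
    using K by (simp add: lipschitz_bound_def)
  have S: "?S \<in> sets (Rborel n)"
    using measurable_sets[OF block1_measurable[OF mn] C] by (simp add: space_Rborel vimage_def Int_def conj_commute)
  have AE_S: "AE \<omega> in M. Z \<omega> \<in> ?S"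
    if Z: "Z \<in> measurable M (Rborel n)" and "support M m (\<lambda>\<omega>. block1 m (Z \<omega>)) \<subseteq> C" for Z
  proof -
    have "AE \<omega> in M. block1 m (Z \<omega>) \<in> support M m (\<lambda>\<omega>. block1 m (Z \<omega>))"
      by (rule AE_in_support) (rule measurable_compose[OF Z block1_measurable[OF mn]])
    then show ?thesis
      using that measurable_space[OF Z] by (auto simp: space_Rborel)
  qed
  \<comment> \<open>A competitor P shares only its law with Z. Lying almost surely in the measurable
    set \<open>?S\<close> is a property of the law.\<close>
  have AE_law: "AE \<omega> in M. P \<omega> \<in> ?S"
    if "P \<in> measurable M (Rborel n)" "Z \<in> measurable M (Rborel n)"
      "distr M (Rborel n) P = distr M (Rborel n) Z" "AE \<omega> in M. Z \<omega> \<in> ?S" for P Z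
  proof -
    have S': "{x \<in> space (Rborel n). x \<in> ?S} \<in> sets (Rborel n)"
      using S by (simp add: space_Rborel)
    have "AE x in distr M (Rborel n) Z. x \<in> ?S"
      using that(4) by (subst AE_distr_iff[OF that(2) S'])
    then show ?thesis
      unfolding that(3)[symmetric] by (subst (asm) AE_distr_iff[OF that(1) S'])
  qed
  have lip: "AE \<omega> in M. \<bar>g (P \<omega>) - g (Q \<omega>)\<bar> \<le> K * vdist a n (P \<omega>) (Q \<omega>)"
    if "AE \<omega> in M. P \<omega> \<in> ?S" "AE \<omega> in M. Q \<omega> \<in> ?S" for P Q
    using that
  proof eventually_elim
    case (elim \<omega>)
    then show ?case
      using K unfolding lipschitz_bound_def by blast
  qed
  have Xm: "X \<in> measurable M (Rborel n)"
    using X by (simp add: Lp_vec_def)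
  have XS: "AE \<omega> in M. X \<omega> \<in> ?S"
    using Xm supp by (rule AE_S)
  have "(\<lambda>\<omega>. g (Z \<omega>)) \<in> ball_real M p (K * \<epsilon>) (\<lambda>\<omega>. g (X \<omega>))"
    if "Z \<in> ball_vec M p a n m \<epsilon> C X" for Z
  proof -
    have Z: "Z \<in> Lp_vec M p a n" "wasserstein_vec M p a n (vcdf M n Z) (vcdf M n X) \<le> \<epsilon>"
      "support M m (\<lambda>\<omega>. block1 m (Z \<omega>)) \<subseteq> C"
      using that by (auto simp: ball_vec_def)
    have Zm: "Z \<in> measurable M (Rborel n)"
      using Z by (simp add: Lp_vec_def)
    have ZS: "AE \<omega> in M. Z \<omega> \<in> ?S"
      using Zm Z(3) by (rule AE_S)
    have gZm: "(\<lambda>\<omega>. g (Z \<omega>)) \<in> borel_measurable M" and gXm: "(\<lambda>\<omega>. g (X \<omega>)) \<in> borel_measurable M"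
      using measurable_compose[OF Zm gm] measurable_compose[OF Xm gm] by auto
    \<comment> \<open>Integrability is known for \<open>g (X \<omega>)\<close>; the Lipschitz bound
      on the difference carries it over to \<open>g (Z \<omega>)\<close>.\<close>
    have "(\<lambda>\<omega>. g (Z \<omega>) - g (X \<omega>)) \<in> Lp_real M p"
    proof (rule Lp_real_dominated)
      show "(\<lambda>\<omega>. K * vdist a n (Z \<omega>) (X \<omega>)) \<in> Lp_real M p"
        by (rule Lp_real_mult[OF vdist_in_Lp_real[OF Z(1) X a p0]])
      show "AE \<omega> in M. \<bar>g (Z \<omega>) - g (X \<omega>)\<bar> \<le> \<bar>K * vdist a n (Z \<omega>) (X \<omega>)\<bar>"
        using lip[OF ZS XS] by (rule eventually_mono) linarith
    qed (use gZm gXm p0 in auto)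
    from Lp_real_add[OF this gX p0] have gZ: "(\<lambda>\<omega>. g (Z \<omega>)) \<in> Lp_real M p"
      by simp
    let ?W = "wasserstein_real M p (rcdf M (\<lambda>\<omega>. g (Z \<omega>))) (rcdf M (\<lambda>\<omega>. g (X \<omega>)))"
    let ?c = "\<lambda>P Q. (LINT \<omega>|M. vdist a n (P \<omega>) (Q \<omega>) powr p) powr (1 / p)"
    have bound: "?W \<le> K * ?c P Q"
      if PQ: "P \<in> measurable M (Rborel n)" "Q \<in> measurable M (Rborel n)"
        "vcdf M n P = vcdf M n Z" "vcdf M n Q = vcdf M n X" for P Q
    proof -
      have law: "distr M (Rborel n) P = distr M (Rborel n) Z" "distr M (Rborel n) Q = distr M (Rborel n) X"
        by (rule vcdf_eq_imp_distr_eq[OF PQ(1) Zm PQ(3)], rule vcdf_eq_imp_distr_eq[OF PQ(2) Xm PQ(4)])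
      have PQL: "P \<in> Lp_vec M p a n" "Q \<in> Lp_vec M p a n"
        by (rule Lp_vec_distr_cong[OF Z(1) PQ(1) law(1)], rule Lp_vec_distr_cong[OF X PQ(2) law(2)])
      have AE: "AE \<omega> in M. \<bar>g (P \<omega>) - g (Q \<omega>)\<bar> \<le> K * vdist a n (P \<omega>) (Q \<omega>)"
        using AE_law[OF PQ(1) Zm law(1) ZS] AE_law[OF PQ(2) Xm law(2) XS] by (rule lip)
      have glaw: "distr M borel (\<lambda>\<omega>. g (P \<omega>)) = distr M borel (\<lambda>\<omega>. g (Z \<omega>))"
        "distr M borel (\<lambda>\<omega>. g (Q \<omega>)) = distr M borel (\<lambda>\<omega>. g (X \<omega>))"
        using distr_distr[OF gm PQ(1)] distr_distr[OF gm PQ(2)] distr_distr[OF gm Zm] distr_distr[OF gm Xm]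
        by (simp_all only: comp_def law)
      have gPQm: "(\<lambda>\<omega>. g (P \<omega>)) \<in> borel_measurable M" "(\<lambda>\<omega>. g (Q \<omega>)) \<in> borel_measurable M"
        using measurable_compose[OF PQ(1) gm] measurable_compose[OF PQ(2) gm] by auto
      have gPQ: "(\<lambda>\<omega>. g (P \<omega>)) \<in> Lp_real M p" "(\<lambda>\<omega>. g (Q \<omega>)) \<in> Lp_real M p"
        using Lp_real_distr_cong[OF gZ gPQm(1) glaw(1)] Lp_real_distr_cong[OF gX gPQm(2) glaw(2)] by auto
      have "?W \<le> (LINT \<omega>|M. \<bar>g (P \<omega>) - g (Q \<omega>)\<bar> powr p) powr (1 / p)"
        by (rule wasserstein_real_le[OF gPQm]) (simp_all only: glaw)
      also have "(LINT \<omega>|M. \<bar>g (P \<omega>) - g (Q \<omega>)\<bar> powr p)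
          \<le> (LINT \<omega>|M. K powr p * vdist a n (P \<omega>) (Q \<omega>) powr p)"
      proof (rule integral_mono_AE)
        show "integrable M (\<lambda>\<omega>. \<bar>g (P \<omega>) - g (Q \<omega>)\<bar> powr p)"
          by (rule Lp_real_integral_diff(1)[OF gPQ p0])
        show "integrable M (\<lambda>\<omega>. K powr p * vdist a n (P \<omega>) (Q \<omega>) powr p)"
          using vdist_in_Lp_real[OF PQL a p0] by (simp add: Lp_real_def vnorm_nonneg)
        show "AE \<omega> in M. \<bar>g (P \<omega>) - g (Q \<omega>)\<bar> powr p \<le> K powr p * vdist a n (P \<omega>) (Q \<omega>) powr p"
          using AE
        proof eventually_elim
          case (elim \<omega>)
          then have "\<bar>g (P \<omega>) - g (Q \<omega>)\<bar> powr p \<le> (K * vdist a n (P \<omega>) (Q \<omega>)) powr p"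
            using p0 by (intro powr_mono2) auto
          then show ?case
            using K0 by (simp add: powr_mult vnorm_nonneg)
        qed
      qed
      then have "(LINT \<omega>|M. \<bar>g (P \<omega>) - g (Q \<omega>)\<bar> powr p) powr (1 / p)
          \<le> (LINT \<omega>|M. K powr p * vdist a n (P \<omega>) (Q \<omega>) powr p) powr (1 / p)"
        using p by (intro powr_mono2) auto
      also have "\<dots> = K * ?c P Q"
        using K0 p by (simp add: powr_mult powr_powr)
      finally show ?thesis .
    qed
    have "?W \<le> K * wasserstein_vec M p a n (vcdf M n Z) (vcdf M n X)"
    \<comment> \<open>For positive K the bound is divided by K to reach the infimum; for K = 0 a
      single coupling already gives distance at most 0.\<close>
    proof (cases "K = 0")
      case True
      then show ?thesis
        using bound[OF Zm Xm] by simp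
    next
      case False
      then have Kpos: "K > 0"
        using K0 by simp
      have "?W / K \<le> wasserstein_vec M p a n (vcdf M n Z) (vcdf M n X)"
        unfolding wasserstein_vec_def
      proof (rule cInf_greatest)
        show "{?c P Q | P Q. P \<in> measurable M (Rborel n) \<and> Q \<in> measurable M (Rborel n) \<and>
            vcdf M n P = vcdf M n Z \<and> vcdf M n Q = vcdf M n X} \<noteq> {}"
          using Zm Xm by blast
        fix c assume "c \<in> {?c P Q | P Q. P \<in> measurable M (Rborel n) \<and> Q \<in> measurable M (Rborel n) \<and>
            vcdf M n P = vcdf M n Z \<and> vcdf M n Q = vcdf M n X}"
        then obtain P Q where "P \<in> measurable M (Rborel n)" "Q \<in> measurable M (Rborel n)"
          "vcdf M n P = vcdf M n Z" "vcdf M n Q = vcdf M n X" and c: "c = ?c P Q"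
          by blast
        then have "?W \<le> K * c"
          unfolding c by (intro bound)
        with Kpos show "?W / K \<le> c"
          by (simp add: divide_le_eq mult.commute)
      qed
      with Kpos show ?thesis
        by (simp add: divide_le_eq mult.commute)
    qed
    also have "\<dots> \<le> K * \<epsilon>"
      using Z(2) K0 by (rule mult_left_mono)
    finally show ?thesis
      using gZ by (simp add: ball_real_def)
  qed
  then show ?thesis
    by (auto simp: rv_image_def)
qed

end

theorem theorem2:
  fixes a p \<epsilon> :: real and b :: ereal and n m :: nat
    and M :: "(nat \<Rightarrow> real) measure"
    and g g' :: "(nat \<Rightarrow> real) \<Rightarrow> real" and \<beta> :: "nat \<Rightarrow> real"
    and X :: "(nat \<Rightarrow> real) \<Rightarrow> (nat \<Rightarrow> real)" and C :: "(nat \<Rightarrow> real) set"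
  assumes "p \<ge> 1" and "a \<ge> 1" and "b \<ge> 1" and "1 / ereal a + 1 / b = 1"
    and "prob_space M" and "sets M = sets (Rborel n)" and "nonatomic M"
    and "m \<le> n" and "\<beta> \<in> Rvec (n - m)"
    and "locally_lipschitz a m g'"
    and "\<forall>x\<in>Rvec n. g x = g' (block1 m x) + (\<Sum>i<n - m. \<beta> i * block2 m n x i)"
    and "\<exists>x\<in>Rvec n. \<exists>y\<in>Rvec n. g x \<noteq> g y"
    and "X \<in> Lp_vec M p a n" and "(\<lambda>\<omega>. g (X \<omega>)) \<in> Lp_real M p"
    and "compactin (Rtop m) C" and "support M m (\<lambda>\<omega>. block1 m (X \<omega>)) \<subseteq> C"
    and "\<epsilon> \<ge> 0"
  defines "K\<^sub>C \<equiv> lipschitz_constant a n {x\<in>Rvec n. block1 m x \<in> C} g"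
    and "L\<^sub>C \<equiv> lipschitz_constant a m C g'"
    and "\<beta>norm \<equiv> vnorm b (n - m) \<beta>"
  shows "ball_real M p (\<beta>norm * \<epsilon>) (\<lambda>\<omega>. g (X \<omega>))
           \<subseteq> law_hull M (rv_image g (ball_vec M p a n m \<epsilon> C X))
       \<and> rv_image g (ball_vec M p a n m \<epsilon> C X)
           \<subseteq> ball_real M p (K\<^sub>C * \<epsilon>) (\<lambda>\<omega>. g (X \<omega>))
       \<and> K\<^sub>C \<le> min (L\<^sub>C + \<beta>norm) (real n powr real_of_ereal (1 / b) * max L\<^sub>C \<beta>norm)"
proof (intro conjI)
  interpret prob_space M by fact
  obtain T where T: "T \<in> borel_measurable M" "\<And>\<omega>. 0 \<le> T \<omega>" "\<And>\<omega>. T \<omega> \<le> (1::real)"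
    "\<And>t. measure M {\<omega>\<in>space M. T \<omega> = t} = 0"
    using atomless_variable[OF assms(5-7)] by blast
  \<comment> \<open>Compactness makes the set of admissible constants nonempty, so that its infimum
    \<open>L\<^sub>C\<close> is itself admissible and can enter the block estimates.\<close>
  obtain L where "lipschitz_bound a m C g' L"
    using locally_lipschitz_on_compact[OF assms(10,2,15)] by blast
  then have "lipschitz_bound a m C g' L\<^sub>C"
    unfolding L\<^sub>C_def by (rule lipschitz_bound_constant)
  note K = block_lipschitz_bounds[OF assms(2-4,8,11) this, folded \<beta>norm_def]
  show "K\<^sub>C \<le> min (L\<^sub>C + \<beta>norm) (real n powr real_of_ereal (1 / b) * max L\<^sub>C \<beta>norm)"
    unfolding K\<^sub>C_def using K by (intro min.boundedI lipschitz_constant_le)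
  show "ball_real M p (\<beta>norm * \<epsilon>) (\<lambda>\<omega>. g (X \<omega>))
      \<subseteq> law_hull M (rv_image g (ball_vec M p a n m \<epsilon> C X))"
    unfolding \<beta>norm_def
    by (rule ball_real_subset_image[OF assms(1-4) T assms(8,11,13,14,16,17)])
  show "rv_image g (ball_vec M p a n m \<epsilon> C X) \<subseteq> ball_real M p (K\<^sub>C * \<epsilon>) (\<lambda>\<omega>. g (X \<omega>))"
  proof (rule image_subset_ball_real[OF assms(1,2,8)])
    \<comment> \<open>A block estimate exhibits one admissible constant on C x R^(n-m), hence the
      infimum is admissible.\<close>
    show "lipschitz_bound a n {x\<in>Rvec n. block1 m x \<in> C} g K\<^sub>C"
      unfolding K\<^sub>C_def using K(1) by (rule lipschitz_bound_constant)
    show "g \<in> borel_measurable (Rborel n)"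
      by (rule block_function_measurable[OF assms(8) locally_lipschitz_measurable[OF assms(10,2)] assms(11)])
    show "C \<in> sets (Rborel m)"
      by (rule closed_imp_sets_Rborel[OF compactin_Rtop_imp_closedin[OF assms(15)]])
  qed fact+
qed

end
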